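(* Let $1\le m\le n$, $\beta\in\mathbb R$, and set $z=(x_1,\dots,x_m)$. (1) Let $1<p<\infty$ and $\Omega\subset\mathbb R^N$ open; if $m+\beta<0$ assume also $\Omega\subset(\mathbb R^m\setminus\{0\})\times\mathbb R^{N-m}$. Then for every $u\in C^1_0(\Omega)$, $$\Big(\frac{|m+\beta|}{p}\Big)^p\int_\Omega|u|^p|z|^\beta d\xi\le\int_\Omega|\nabla_\gamma u|^p|z|^{p+\beta}d\xi,$$ and in particular $\big(\frac{|m-p|}{p}\big)^p\int_\Omega\frac{|u|^p}{\|\xi\|_\gamma^p}d\xi\le\big(\frac{|m-p|}{p}\big)^p\int_\Omega\frac{|u|^p}{|z|^p}d\xi\le\int_\Omega|\nabla_\gamma u|^pd\xi$. If $(B^m_r\setminus\{0\})\times B^{N-m}_r\subset\Omega$ for some $r>0$, the constant $(|m+\beta|/p)^p$ is sharp. (2) Let $p=m>1$, $R>0$, $\Omega=\{\xi=(z,x_{m+1},\dots,x_n,y):|z|<R\}$ and $\beta<-1$. Then for every $u\in C^1_0(\Omega)$, $$\Big(\frac{|\beta+1|}{p}\Big)^p\int_\Omega\frac{|u|^p}{|z|^p}\Big(\ln\frac R{|z|}\Big)^\beta d\xi\le\int_\Omega|\nabla_\gamma u|^p\Big(\ln\frac R{|z|}\Big)^{p+\beta}d\xi,$$ in particular $\big(\frac{p-1}{p}\big)^p\int_\Omega\frac{|u|^p}{(|z|\ln(R/|z|))^p}d\xi\le\int_\Omega|\nabla_\gamma u|^pd\xi$; the constant $(|\beta+1|/p)^p$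 is sharp.
   Context: $\mathbb R^N$ is split as $\xi=(x,y)\in\mathbb R^n\times\mathbb R^k$, $\gamma\ge0$, $\nabla_\gamma=(\nabla_x,|x|^\gamma\nabla_y)$, and $\|\xi\|_\gamma:=\big(|x|^{2(1+\gamma)}+(1+\gamma)^2|y|^2\big)^{1/(2+2\gamma)}$. $B^s_r$ denotes the Euclidean ball in $\mathbb R^s$ of radius $r$ centred at the origin. "Sharp" means the constant cannot be replaced by any larger one. *)

theory Defs
  imports "HOL-Analysis.Analysis"
begin

text \<open>Points of R^N = R^n x R^k are pairs (x,y) :: (real^'n) x (real^'k).
  The variable z consists of the coordinates of x indexed by a set M of m indices.\<close>

definition znorm :: "'n::finite set \<Rightarrow> (real^'n) \<times> (real^'k::finite) \<Rightarrow> real" where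
  "znorm M \<xi> = sqrt (\<Sum>i\<in>M. (fst \<xi> $ i)^2)"

definition restnorm :: "'n::finite set \<Rightarrow> (real^'n) \<times> (real^'k::finite) \<Rightarrow> real" where
  "restnorm M \<xi> = sqrt ((\<Sum>i\<in>-M. (fst \<xi> $ i)^2) + (norm (snd \<xi>))^2)"

definition gauge_norm :: "real \<Rightarrow> (real^'n::finite) \<times> (real^'k::finite) \<Rightarrow> real" where
  "gauge_norm \<gamma> \<xi> = ((norm (fst \<xi>)) powr (2*(1+\<gamma>)) + (1+\<gamma>)^2 * (norm (snd \<xi>))^2)
                        powr (1 / (2 + 2*\<gamma>))"

definition grad_x :: "((real^'n::finite) \<times> (real^'k::finite) \<Rightarrow> real) \<Rightarrow> (real^'n) \<times> (real^'k) \<Rightarrow> real^'n" where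
  "grad_x u \<xi> = (\<chi> i. frechet_derivative u (at \<xi>) (axis i 1, 0))"

definition grad_y :: "((real^'n::finite) \<times> (real^'k::finite) \<Rightarrow> real) \<Rightarrow> (real^'n) \<times> (real^'k) \<Rightarrow> real^'k" where
  "grad_y u \<xi> = (\<chi> j. frechet_derivative u (at \<xi>) (0, axis j 1))"

definition xweight :: "real \<Rightarrow> (real^'n::finite) \<times> (real^'k::finite) \<Rightarrow> real" where
  "xweight \<gamma> \<xi> = (if \<gamma> = 0 then 1 else norm (fst \<xi>) powr \<gamma>)"

text \<open>|nabla_gamma u| where nabla_gamma = (nabla_x, |x|^gamma nabla_y).\<close>
definition grad_gamma_norm :: "real \<Rightarrow> ((real^'n::finite) \<times> (real^'k::finite) \<Rightarrow> real) \<Rightarrow> (real^'n) \<times> (real^'k) \<Rightarrow> real" where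
  "grad_gamma_norm \<gamma> u \<xi> = sqrt ((norm (grad_x u \<xi>))^2 + (xweight \<gamma> \<xi> * norm (grad_y u \<xi>))^2)"

text \<open>C^1_0(Omega): continuously differentiable functions (extended by zero to R^N)
  whose support is compact and contained in Omega.\<close>
definition C1_0 :: "((real^'n::finite) \<times> (real^'k::finite)) set \<Rightarrow> ((real^'n) \<times> (real^'k) \<Rightarrow> real) \<Rightarrow> bool" where
  "C1_0 \<Omega> u \<longleftrightarrow>
     (\<exists>D. continuous_on UNIV D \<and> (\<forall>\<xi>. (u has_derivative blinfun_apply (D \<xi>)) (at \<xi>)))
     \<and> compact (closure {\<xi>. u \<xi> \<noteq> 0}) \<and> closure {\<xi>. u \<xi> \<noteq> 0} \<subseteq> \<Omega>"

end

theory Submission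
  imports Defs "HOL-Real_Asymp.Real_Asymp"
begin

text \<open>Hardy inequality: along the orbits of the dilations of the variable \<open>z\<close> it is a one-dimensional
  weighted inequality, obtained by integrating the derivative of \<open>|f|\<^sup>p exp (p a \<rho>)\<close> and applying
  Young's inequality pointwise. The measure \<open>|z|\<^sup>-\<^sup>m d\<xi>\<close> is invariant under these dilations, so
  Tonelli's theorem reassembles the orbits without polar coordinates or a divergence theorem.
  Part (1) is the case \<open>\<rho>(t) = t\<close>, part (2) the case \<open>\<rho>(t) = - ln (ln R - t)\<close>, with \<open>t = ln |z|\<close>.

  Sharpness: \<open>exp (- a \<rho>)\<close>, cut off in \<open>\<rho>\<close> with a plateau much longer than its transition zones,
  reduces the comparison of the two integrals to a comparison of volumes.\<close>

subsection \<open>The one-dimensional inequality\<close>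

text \<open>Why the constant is exact: with the factor
  \<open>k = sgn a * \<bar>a\<bar> powr (p - 1)\<close>, the derivative of the weight contributes
  \<open>p\<close> copies of |a|^p |f|^p, Young's inequality spends \<open>p - 1\<close> of them on
  the cross term, and one survives. Equality in Young forces |f'| = |a| \<rho>' |f|, which singles
  out exp(-a \<rho>): there the weights cancel and both integrands become constant multiples of
  \<rho>'. Integrals turn into \<rho>-lengths, and the full \<rho>-length is infinite, hence the
  cutoff. The sign of \<open>k\<close> settles the behaviour at z = 0. The degenerate weight
  |x|^\<gamma> cannot spoil the inequality: the derivative along a dilation of z involves only
  x-derivatives, which carry weight 1. For sharpness it suffices that the weight is bounded on the
  supports, since derivatives in the other variables enter with an extra factor |z|/\<rho>', which
  tends to 0 as |z| does. Integrals of nonnegative extended reals are used throughout, so infinite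
  right-hand sides are covered too.\<close>

text \<open>Only \<open>x = 0\<close> is delicate: the difference quotient has modulus |h|^(p-1),
  which tends to 0 because p > 1. No smoothing of the absolute value at zeros of \<open>f\<close> is
  then required.\<close>

lemma has_real_derivative_abs_powr:
  fixes p :: real
  assumes "p > 1"
  shows "((\<lambda>x. \<bar>x\<bar> powr p) has_real_derivative p * \<bar>x\<bar> powr (p - 1) * sgn x) (at x)"
proof -
  consider "x > 0" | "x < 0" | "x = 0" by linarith
  then show ?thesis
  proof cases
    case 1
    have "((\<lambda>x. x powr p) has_real_derivative p * x powr (p - 1)) (at x)"
      using 1 by (auto intro!: derivative_eq_intros)
    then have "((\<lambda>x. \<bar>x\<bar> powr p) has_real_derivative p * x powr (p - 1)) (at x)"
      by (rule has_field_derivative_transform_within_open[where S="{0<..}"]) (use 1 in auto)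
    then show ?thesis using 1 by simp
  next
    case 2
    have "((\<lambda>x. (- x) powr p) has_real_derivative - (p * (- x) powr (p - 1))) (at x)"
      using 2 by (auto intro!: derivative_eq_intros)
    then have "((\<lambda>x. \<bar>x\<bar> powr p) has_real_derivative - (p * (- x) powr (p - 1))) (at x)"
      by (rule has_field_derivative_transform_within_open[where S="{..<0}"]) (use 2 in auto)
    then show ?thesis using 2 by simp
  next
    case 3
    have "((\<lambda>h::real. \<bar>h\<bar> powr (p - 1)) \<longlongrightarrow> \<bar>0\<bar> powr (p - 1)) (at 0)"
      by (rule tendsto_powr2[OF tendsto_rabs[OF tendsto_ident_at] tendsto_const]) (use assms in auto)
    moreover have "\<forall>\<^sub>F h::real in at 0. \<bar>h\<bar> powr (p - 1) = norm (\<bar>h\<bar> powr p / h)"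
      by (rule eventually_at_filter[THEN iffD2, OF always_eventually]) (auto simp: powr_diff abs_mult)
    ultimately have "((\<lambda>h::real. norm (\<bar>h\<bar> powr p / h)) \<longlongrightarrow> \<bar>0\<bar> powr (p - 1)) (at 0)"
      by (rule Lim_transform_eventually)
    then have "((\<lambda>h::real. \<bar>h\<bar> powr p / h) \<longlongrightarrow> 0) (at 0)"
      using assms by (intro tendsto_norm_zero_cancel[of "\<lambda>h. \<bar>h\<bar> powr p / h"]) simp
    then show ?thesis using 3
      by (simp add: has_field_derivative_iff)
  qed
qed

text \<open>Young's inequality for \<open>Y\<close> and \<open>X powr (p - 1)\<close> with conjugate
  exponent \<open>p / (p - 1)\<close>, multiplied by \<open>p\<close>. Equality at
  \<open>X = Y\<close> is what keeps the Hardy constant sharp.\<close>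

lemma Young_powr:
  fixes p X Y :: real
  assumes "p > 1" "X \<ge> 0" "Y \<ge> 0"
  shows "p * X powr (p - 1) * Y \<le> (p - 1) * X powr p + Y powr p"
proof -
  define q where "q = p / (p - 1)"
  have q: "q > 1" "1 / p + 1 / q = 1" using assms by (auto simp: q_def field_simps)
  have "Y * X powr (p - 1) \<le> Y powr p / p + (X powr (p - 1)) powr q / q"
    by (rule Youngs_inequality) (use assms q in auto)
  moreover have "(X powr (p - 1)) powr q = X powr p" using assms by (simp add: powr_powr q_def)
  ultimately have "p * (Y * X powr (p - 1)) \<le> p * (Y powr p / p + X powr p / q)"
    using assms by (intro mult_left_mono) auto
  also have "\<dots> = (p - 1) * X powr p + Y powr p" using assms by (simp add: q_def field_simps)
  finally show ?thesis by (simp add: mult_ac)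
qed

lemma continuous_on_abs_powr:
  fixes g :: "'a::topological_space \<Rightarrow> real"
  assumes "continuous_on S g" "q > 0"
  shows "continuous_on S (\<lambda>t. \<bar>g t\<bar> powr q)"
  using assms by (intro continuous_on_powr' continuous_on_rabs continuous_on_const) auto

text \<open>\<open>G'\<close> may change sign and has no place in an \<open>ennreal\<close>
  integral. The comparison is therefore made with Bochner integrals of continuous functions on a
  compact interval and only then transferred.\<close>

lemma nn_integral_le_FTC:
  fixes G G' P Q :: "real \<Rightarrow> real"
  assumes cd: "c \<le> d"
    and G: "\<And>t. t \<in> {c..d} \<Longrightarrow> (G has_real_derivative G' t) (at t)" "G d \<le> G c"
    and cont: "continuous_on {c..d} G'" "continuous_on {c..d} P" "continuous_on {c..d} Q"
    and nonneg: "\<And>t. t \<in> {c..d} \<Longrightarrow> P t \<ge> 0" "\<And>t. t \<in> {c..d} \<Longrightarrow> Q t \<ge> 0"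
    and le: "\<And>t. t \<in> {c..d} \<Longrightarrow> P t \<le> G' t + Q t"
  shows "(\<integral>\<^sup>+t\<in>{c..d}. ennreal (P t) \<partial>lborel) \<le> (\<integral>\<^sup>+t\<in>{c..d}. ennreal (Q t) \<partial>lborel)"
proof -
  let ?I = "\<lambda>h. \<integral>t. indicator {c..d} t *\<^sub>R h t \<partial>lborel"
  have int: "integrable lborel (\<lambda>t. indicator {c..d} t *\<^sub>R h t)" if "continuous_on {c..d} h" for h :: "real \<Rightarrow> real"
    using borel_integrable_atLeastAtMost'[OF that] by (simp add: set_integrable_def)
  have FTC: "?I G' = G d - G c"
    using G by (intro integral_FTC_atLeastAtMost cd cont)
      (auto simp: has_real_derivative_iff_has_vector_derivative[symmetric] intro: DERIV_subset)
  have "?I P \<le> ?I (\<lambda>t. G' t + Q t)"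
    by (intro integral_mono int cont continuous_on_add) (auto simp: indicator_def le)
  also have "\<dots> = ?I G' + ?I Q"
    using int[OF cont(1)] int[OF cont(3)] by (simp add: scaleR_add_right del: real_scaleR_def)
  also have "\<dots> \<le> ?I Q" using FTC G(2) by simp
  finally have "?I P \<le> ?I Q" .
  moreover have nn: "(\<integral>\<^sup>+t\<in>{c..d}. ennreal (h t) \<partial>lborel) = ennreal (?I h)"
    if "continuous_on {c..d} h" "\<And>t. t \<in> {c..d} \<Longrightarrow> h t \<ge> 0" for h :: "real \<Rightarrow> real"
    by (subst nn_integral_eq_integral[symmetric, OF int[OF that(1)]])
      (auto simp: indicator_def that intro!: nn_integral_cong AE_I2)
  ultimately show ?thesis
    using nn[OF cont(2) nonneg(1)] nn[OF cont(3) nonneg(2)] by (simp add: ennreal_leI)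
qed

lemma hardy_interval:
  fixes f f' \<rho> \<rho>' :: "real \<Rightarrow> real" and p a c d :: real
  assumes p: "p > 1" and cd: "c \<le> d"
    and f: "\<And>t. t \<in> {c..d} \<Longrightarrow> (f has_real_derivative f' t) (at t)" "continuous_on {c..d} f'"
    and \<rho>: "\<And>t. t \<in> {c..d} \<Longrightarrow> (\<rho> has_real_derivative \<rho>' t) (at t)" "continuous_on {c..d} \<rho>'"
           "\<And>t. t \<in> {c..d} \<Longrightarrow> \<rho>' t > 0"
    and f0: "f d = 0" "a < 0 \<Longrightarrow> f c = 0"
  shows "(\<integral>\<^sup>+t\<in>{c..d}. ennreal (\<bar>a\<bar> powr p * (\<bar>f t\<bar> powr p * (exp (p * a * \<rho> t) * \<rho>' t))) \<partial>lborel)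
       \<le> (\<integral>\<^sup>+t\<in>{c..d}. ennreal (\<bar>f' t\<bar> powr p * (exp (p * a * \<rho> t) * \<rho>' t powr (1 - p))) \<partial>lborel)"
    (is "(\<integral>\<^sup>+t\<in>_. ennreal (?P t) \<partial>lborel) \<le> (\<integral>\<^sup>+t\<in>_. ennreal (?Q t) \<partial>lborel)")
proof -
  define G where "G t = \<bar>f t\<bar> powr p * exp (p * a * \<rho> t)" for t
  define G' where "G' t = p * \<bar>f t\<bar> powr (p - 1) * sgn (f t) * f' t * exp (p * a * \<rho> t)
      + \<bar>f t\<bar> powr p * (exp (p * a * \<rho> t) * (p * a * \<rho>' t))" for t
  \<comment> \<open>Chosen so that \<open>k * a = \<bar>a\<bar> powr p\<close>, while
    \<open>k * sgn (f t)\<close> has modulus at most |a|^(p-1). Its sign agrees with that of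
    \<open>a\<close>, which fixes the sign of the boundary term.\<close>
  define k where "k = sgn a * \<bar>a\<bar> powr (p - 1)"
  have contf: "continuous_on {c..d} f"
    using f(1) by (meson continuous_at_imp_continuous_on DERIV_isCont)
  have cont\<rho>: "continuous_on {c..d} \<rho>"
    using \<rho>(1) by (meson atMost_iff continuous_at_imp_continuous_on DERIV_isCont)
  \<comment> \<open>\<open>sgn\<close> is discontinuous; splitting into positive and negative parts
    shows that its product with the power is continuous.\<close>
  have sgnpow: "\<bar>x\<bar> powr (p - 1) * sgn x = max 0 x powr (p - 1) - max 0 (- x) powr (p - 1)" for x
    by (auto simp: sgn_if max_def)
  have contsgn: "continuous_on {c..d} (\<lambda>t. \<bar>f t\<bar> powr (p - 1) * sgn (f t))"
  proof -
    have "continuous_on {c..d} (\<lambda>t. \<bar>max 0 (f t)\<bar> powr (p - 1) - \<bar>max 0 (- f t)\<bar> powr (p - 1))"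
      using p by (intro continuous_on_diff continuous_on_abs_powr continuous_on_max continuous_on_const
          continuous_on_minus contf) auto
    then show ?thesis by (simp add: sgnpow)
  qed
  have G: "(G has_real_derivative G' t) (at t)" if "t \<in> {c..d}" for t
  proof -
    have 1: "((\<lambda>t. \<bar>f t\<bar> powr p) has_real_derivative p * \<bar>f t\<bar> powr (p - 1) * sgn (f t) * f' t) (at t)"
      by (rule DERIV_chain2[OF has_real_derivative_abs_powr[OF p] f(1)[OF that]])
    have 2: "((\<lambda>t. exp (p * a * \<rho> t)) has_real_derivative exp (p * a * \<rho> t) * (p * a * \<rho>' t)) (at t)"
      by (rule DERIV_chain2[OF DERIV_exp DERIV_cmult[OF \<rho>(1)[OF that]]])
    show ?thesis using DERIV_mult'[OF 1 2] unfolding G_def G'_def by (simp add: add.commute)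
  qed
  have contG': "continuous_on {c..d} G'"
  proof -
    have "continuous_on {c..d} (\<lambda>t. p * (\<bar>f t\<bar> powr (p - 1) * sgn (f t)) * f' t * exp (p * a * \<rho> t)
      + \<bar>f t\<bar> powr p * (exp (p * a * \<rho> t) * (p * a * \<rho>' t)))"
      using p by (intro continuous_on_add continuous_on_mult continuous_on_exp continuous_on_const
          contsgn f(2) \<rho>(2) cont\<rho> continuous_on_abs_powr contf) auto
    then show ?thesis by (simp add: G'_def mult.assoc cong: continuous_on_cong)
  qed
  have contQ: "continuous_on {c..d} ?Q"
  proof -
    have "continuous_on {c..d} (\<lambda>t. \<rho>' t powr (1 - p))"
      using \<rho>(3) by (intro continuous_on_powr \<rho>(2) continuous_on_const) force
    then show ?thesis
      using p by (intro continuous_on_mult continuous_on_exp continuous_on_const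
          f(2) cont\<rho> continuous_on_abs_powr) auto
  qed
  have contP: "continuous_on {c..d} ?P"
    using p by (intro continuous_on_mult continuous_on_exp continuous_on_const
        \<rho>(2) cont\<rho> continuous_on_abs_powr contf) auto
  have pw: "?P t \<le> k * G' t + ?Q t" if t: "t \<in> {c..d}" for t
  proof -
    \<comment> \<open>After division by \<open>E\<close> the claim no longer contains the weights:
      it compares |a f| with \<open>v\<close>, the derivative of \<open>f\<close> with respect to
      the variable \<rho>.\<close>
    define E where "E = exp (p * a * \<rho> t) * \<rho>' t"
    define v where "v = f' t / \<rho>' t"
    have r: "\<rho>' t > 0" using \<rho>(3) t by auto
    have E: "E > 0" using r by (simp add: E_def)
    have kv: "\<bar>k * sgn (f t)\<bar> \<le> \<bar>a\<bar> powr (p - 1)"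
      by (auto simp: k_def abs_mult sgn_if)
    have ap: "k * a = \<bar>a\<bar> powr p"
      by (cases "a = 0") (auto simp: k_def sgn_if powr_diff)
    have G'_eq: "G' t = E * (p * \<bar>f t\<bar> powr (p - 1) * sgn (f t) * v + p * a * \<bar>f t\<bar> powr p)"
      using r by (simp add: G'_def E_def v_def algebra_simps)
    have Q_eq: "?Q t = E * \<bar>v\<bar> powr p"
      using r by (simp add: E_def v_def powr_divide powr_diff abs_divide)
    have P_eq: "?P t = E * (\<bar>a\<bar> powr p * \<bar>f t\<bar> powr p)" by (simp add: E_def)
    have "- (p * \<bar>f t\<bar> powr (p - 1) * (k * sgn (f t)) * v) \<le> \<bar>p * \<bar>f t\<bar> powr (p - 1) * (k * sgn (f t)) * v\<bar>"
      by linarith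
    also have "\<dots> = p * \<bar>f t\<bar> powr (p - 1) * \<bar>k * sgn (f t)\<bar> * \<bar>v\<bar>"
      using p by (simp add: abs_mult)
    also have "\<dots> \<le> p * \<bar>f t\<bar> powr (p - 1) * \<bar>a\<bar> powr (p - 1) * \<bar>v\<bar>"
      using p kv by (intro mult_right_mono mult_left_mono) auto
    also have "\<dots> = p * (\<bar>a\<bar> * \<bar>f t\<bar>) powr (p - 1) * \<bar>v\<bar>"
      by (simp add: powr_mult)
    also have "\<dots> \<le> (p - 1) * (\<bar>a\<bar> * \<bar>f t\<bar>) powr p + \<bar>v\<bar> powr p"
      by (rule Young_powr) (use p in auto)
    also have "\<dots> = (p - 1) * (\<bar>a\<bar> powr p * \<bar>f t\<bar> powr p) + \<bar>v\<bar> powr p"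
      by (simp add: powr_mult)
    finally have "\<bar>a\<bar> powr p * \<bar>f t\<bar> powr p \<le> p * \<bar>f t\<bar> powr (p - 1) * (k * sgn (f t)) * v
        + p * (k * a) * \<bar>f t\<bar> powr p + \<bar>v\<bar> powr p"
      unfolding ap by (simp add: algebra_simps)
    then have "E * (\<bar>a\<bar> powr p * \<bar>f t\<bar> powr p) \<le> E * (p * \<bar>f t\<bar> powr (p - 1) * (k * sgn (f t)) * v
        + p * (k * a) * \<bar>f t\<bar> powr p + \<bar>v\<bar> powr p)"
      using E by (intro mult_left_mono) auto
    then show ?thesis unfolding G'_eq Q_eq P_eq by (simp add: algebra_simps)
  qed
  show ?thesis
  proof (rule nn_integral_le_FTC[where G="\<lambda>t. k * G t" and G'="\<lambda>t. k * G' t"])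
    \<comment> \<open>\<open>G d = 0\<close> by \<open>f0\<close>. For a >= 0 the right side is
      nonnegative; for a < 0 it is zero because \<open>f c = 0\<close>.\<close>
    show "k * G d \<le> k * G c"
      using f0 p by (auto simp: G_def k_def sgn_if)
    show "((\<lambda>t. k * G t) has_real_derivative k * G' t) (at t)" if "t \<in> {c..d}" for t
      by (rule DERIV_cmult[OF G[OF that]])
    show "continuous_on {c..d} (\<lambda>t. k * G' t)"
      by (rule continuous_on_mult_left[OF contG'])
    show "?P t \<ge> 0" "?Q t \<ge> 0" if "t \<in> {c..d}" for t
      using \<rho>(3)[OF that] by (intro mult_nonneg_nonneg; simp)+
  qed (fact cd contP contQ pw)+
qed

text \<open>Exhaustion by compact intervals: the left integral is the supremum of its truncations,
  and each truncated right integral is at most the full one, so a limit is needed on one side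
  only.\<close>

lemma hardy_half_line:
  fixes f f' \<rho> \<rho>' :: "real \<Rightarrow> real" and p a d :: real
  assumes p: "p > 1"
    and f: "\<And>t. (f has_real_derivative f' t) (at t)" "continuous_on UNIV f'"
    and \<rho>: "\<And>t. t \<le> d \<Longrightarrow> (\<rho> has_real_derivative \<rho>' t) (at t)" "continuous_on {..d} \<rho>'"
           "\<And>t. t \<le> d \<Longrightarrow> \<rho>' t > 0"
    and f0: "\<And>t. t \<ge> d \<Longrightarrow> f t = 0" "a < 0 \<Longrightarrow> \<exists>c. \<forall>t\<le>c. f t = 0"
  shows "(\<integral>\<^sup>+t\<in>{..d}. ennreal (\<bar>a\<bar> powr p * (\<bar>f t\<bar> powr p * (exp (p * a * \<rho> t) * \<rho>' t))) \<partial>lborel)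
       \<le> (\<integral>\<^sup>+t\<in>{..d}. ennreal (\<bar>f' t\<bar> powr p * (exp (p * a * \<rho> t) * \<rho>' t powr (1 - p))) \<partial>lborel)"
    (is "(\<integral>\<^sup>+t\<in>_. ennreal (?P t) \<partial>lborel) \<le> (\<integral>\<^sup>+t\<in>_. ennreal (?Q t) \<partial>lborel)")
proof -
  have "\<exists>c. a < 0 \<longrightarrow> (\<forall>t\<le>c. f t = 0)" using f0(2) by blast
  then obtain c where c: "\<And>t. a < 0 \<Longrightarrow> t \<le> c \<Longrightarrow> f t = 0" by blast
  \<comment> \<open>The left endpoints stay below \<open>c\<close>, so for a < 0 the function
    vanishes there, as \<open>hardy_interval\<close> demands.\<close>
  define K where "K n = {min c d - real n..d}" for n :: nat
  have contf: "continuous_on {..d} f"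
    using f(1) by (meson continuous_at_imp_continuous_on DERIV_isCont)
  have cont\<rho>: "continuous_on {..d} \<rho>"
    using \<rho>(1) by (meson atMost_iff continuous_at_imp_continuous_on DERIV_isCont)
  have contP: "continuous_on {..d} ?P"
    using p by (intro continuous_on_mult continuous_on_exp continuous_on_const
        \<rho>(2) cont\<rho> continuous_on_abs_powr contf) auto
  have "(\<lambda>t. if t \<in> {..d} then ?P t else 0) \<in> borel_measurable borel"
    by (intro borel_measurable_continuous_on_if contP) auto
  then have Pm: "(\<lambda>t. ennreal (if t \<in> {..d} then ?P t else 0)) \<in> borel_measurable borel"
    by measurable
  define P where "P t = ennreal (?P t)" for t
  have Pm': "(\<lambda>t. (if t \<in> {..d} then P t else 0)) \<in> borel_measurable borel"
  proof -
    have "(\<lambda>t. ennreal (if t \<in> {..d} then ?P t else 0)) = (\<lambda>t. (if t \<in> {..d} then P t else 0))"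
      unfolding P_def by (rule ext, case_tac "t \<in> {..d}") (simp_all only: if_True if_False ennreal_0 simp_thms)
    with Pm show ?thesis by (simp only:)
  qed
  have SUP: "P t * indicator {..d} t = (SUP n. P t * indicator (K n) t)" for t
  proof (cases "t \<le> d")
    case True
    obtain n :: nat where "real n \<ge> min c d - t" using real_arch_simple by blast
    then have n: "t \<in> K n" using True by (auto simp: K_def)
    show ?thesis
    proof (rule antisym)
      show "(SUP n. P t * indicator (K n) t) \<le> P t * indicator {..d} t"
        by (intro SUP_least mult_left_mono) (auto simp: K_def split: split_indicator)
      show "P t * indicator {..d} t \<le> (SUP n. P t * indicator (K n) t)"
        by (rule SUP_upper2[of n]) (use n True in auto)
    qed
  qed (auto simp: K_def)
  have "(\<integral>\<^sup>+t\<in>{..d}. P t \<partial>lborel) = (\<integral>\<^sup>+t. (SUP n. P t * indicator (K n) t) \<partial>lborel)"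
    by (simp add: SUP)
  also have "\<dots> = (SUP n. (\<integral>\<^sup>+t. P t * indicator (K n) t \<partial>lborel))"
  proof (rule nn_integral_monotone_convergence_SUP)
    show "incseq (\<lambda>n t. P t * indicator (K n) t)"
      by (intro incseq_SucI le_funI mult_left_mono) (auto simp: K_def split: split_indicator)
    show "(\<lambda>t. P t * indicator (K n) t) \<in> borel_measurable lborel" for n
    proof -
      have "(\<lambda>t. (if t \<in> {..d} then P t else 0) * indicator (K n) t) \<in> borel_measurable lborel"
        using Pm' by (auto simp: K_def)
      also have "(\<lambda>t. (if t \<in> {..d} then P t else 0) * indicator (K n) t)
          = (\<lambda>t. P t * indicator (K n) t)"
        by (auto simp: K_def indicator_def fun_eq_iff)
      finally show ?thesis .
    qed
  qed
  also have "\<dots> \<le> (\<integral>\<^sup>+t\<in>{..d}. ennreal (?Q t) \<partial>lborel)"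
  proof (rule SUP_least)
    fix n
    have "(\<integral>\<^sup>+t. P t * indicator (K n) t \<partial>lborel) \<le> (\<integral>\<^sup>+t\<in>K n. ennreal (?Q t) \<partial>lborel)"
      unfolding K_def P_def
      by (rule hardy_interval)
        (use p f \<rho> f0(1) c in \<open>auto intro: continuous_on_subset\<close>)
    also have "\<dots> \<le> (\<integral>\<^sup>+t\<in>{..d}. ennreal (?Q t) \<partial>lborel)"
      by (intro nn_integral_mono) (auto simp: K_def indicator_def)
    finally show "(\<integral>\<^sup>+t. P t * indicator (K n) t \<partial>lborel) \<le> (\<integral>\<^sup>+t\<in>{..d}. ennreal (?Q t) \<partial>lborel)" .
  qed
  finally show ?thesis by (simp add: P_def)
qed

subsection \<open>Coordinate projections and dilations\<close>

definition proj :: "'a::euclidean_space set \<Rightarrow> 'a \<Rightarrow> 'a" where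
  "proj S x = (\<Sum>b\<in>S. (x \<bullet> b) *\<^sub>R b)"

lemma bounded_linear_proj: "bounded_linear (proj S)"
  unfolding proj_def[abs_def]
  by (intro bounded_linear_sum bounded_linear_scaleR_const bounded_linear_inner_left)

lemmas continuous_on_proj [continuous_intros] = bounded_linear.continuous_on[OF bounded_linear_proj]
lemmas proj_simps [simp] =
  linear_add[OF bounded_linear.linear[OF bounded_linear_proj]]
  linear_diff[OF bounded_linear.linear[OF bounded_linear_proj]]
  linear_scale[OF bounded_linear.linear[OF bounded_linear_proj]]
  linear_0[OF bounded_linear.linear[OF bounded_linear_proj]]

lemma measurable_proj [measurable]: "proj S \<in> borel_measurable borel"
  by (intro borel_measurable_continuous_onI continuous_intros)

lemma inner_proj_Basis:
  assumes "S \<subseteq> Basis" "b \<in> Basis"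
  shows "proj S x \<bullet> b = (if b \<in> S then x \<bullet> b else 0)"
proof -
  have "finite S" using assms finite_subset finite_Basis by blast
  have "proj S x \<bullet> b = (\<Sum>c\<in>S. if b = c then x \<bullet> b else 0)"
    unfolding proj_def inner_sum_left
    by (rule sum.cong) (use assms in \<open>auto simp: inner_Basis subset_iff\<close>)
  then show ?thesis using \<open>finite S\<close> by simp
qed

lemma proj_proj:
  assumes "S \<subseteq> Basis" "T \<subseteq> Basis"
  shows "proj S (proj T x) = proj (S \<inter> T) x"
  by (rule euclidean_eqI) (use assms in \<open>auto simp: inner_proj_Basis le_infI1\<close>)

lemma proj_empty [simp]: "proj {} x = 0"
  by (simp add: proj_def)

lemma proj_compl: "S \<subseteq> Basis \<Longrightarrow> proj (Basis - S) x = x - proj S x"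
  by (rule euclidean_eqI) (auto simp: inner_proj_Basis inner_diff_left)

lemma norm_proj:
  assumes "S \<subseteq> Basis"
  shows "norm (proj S x) = sqrt (\<Sum>b\<in>S. (x \<bullet> b)\<^sup>2)"
proof -
  have "norm (proj S x) = sqrt (\<Sum>b\<in>Basis. (proj S x \<bullet> b)\<^sup>2)"
    by (simp add: norm_eq_sqrt_inner euclidean_inner[of "proj S x" "proj S x"] power2_eq_square)
  also have "(\<Sum>b\<in>Basis. (proj S x \<bullet> b)\<^sup>2) = (\<Sum>b\<in>Basis. if b \<in> S then (x \<bullet> b)\<^sup>2 else 0)"
    by (rule sum.cong) (use assms in \<open>auto simp: inner_proj_Basis\<close>)
  also have "\<dots> = (\<Sum>b\<in>S. (x \<bullet> b)\<^sup>2)"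
    using assms by (simp add: sum.inter_restrict[symmetric] Int_absorb1)
  finally show ?thesis .
qed

lemma norm_proj_Pythagoras:
  assumes "S \<subseteq> Basis"
  shows "(norm x)\<^sup>2 = (norm (proj S x))\<^sup>2 + (norm (proj (Basis - S) x))\<^sup>2"
proof -
  have "(norm x)\<^sup>2 = (\<Sum>b\<in>Basis. (x \<bullet> b)\<^sup>2)"
    using norm_proj[of Basis x] by (simp add: sum_nonneg proj_def euclidean_representation)
  then show ?thesis using assms
    by (simp add: norm_proj sum_nonneg sum.subset_diff[OF assms])
qed

text \<open>The first factor moves along the orbits, with the second equal to 1. The second factor
  serves to compare cylinders of different radii in the remaining coordinates.\<close>

definition dil :: "'a::euclidean_space set \<Rightarrow> real \<Rightarrow> real \<Rightarrow> 'a \<Rightarrow> 'a" where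
  "dil S l k x = l *\<^sub>R proj S x + k *\<^sub>R proj (Basis - S) x"

lemma proj_dil:
  assumes "S \<subseteq> Basis"
  shows "proj S (dil S l k x) = l *\<^sub>R proj S x"
    and "proj (Basis - S) (dil S l k x) = k *\<^sub>R proj (Basis - S) x"
proof -
  have "S \<inter> (Basis - S) = {}" "(Basis - S) \<inter> S = {}" by auto
  then show "proj S (dil S l k x) = l *\<^sub>R proj S x"
    and "proj (Basis - S) (dil S l k x) = k *\<^sub>R proj (Basis - S) x"
    using assms by (simp_all add: dil_def proj_proj)
qed

lemma dil_dil:
  assumes "S \<subseteq> Basis"
  shows "dil S l k (dil S l' k' x) = dil S (l * l') (k * k') x"
  unfolding dil_def[of S l k] proj_dil[OF assms] by (simp add: dil_def)

lemma dil_1_1 [simp]: "S \<subseteq> Basis \<Longrightarrow> dil S 1 1 x = x"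
  by (simp add: dil_def proj_compl)

lemma measurable_dil [measurable (raw)]:
  assumes "l \<in> borel_measurable N" "k \<in> borel_measurable N" "f \<in> borel_measurable N"
  shows "(\<lambda>x. dil S (l x) (k x) (f x)) \<in> borel_measurable N"
  using assms unfolding dil_def by measurable

lemma nn_integral_dil:
  fixes h :: "'a::euclidean_space \<Rightarrow> ennreal"
  assumes S: "S \<subseteq> Basis" and h [measurable]: "h \<in> borel_measurable borel" and "l > 0" "k > 0"
  shows "(\<integral>\<^sup>+x. h x \<partial>lborel)
       = ennreal (l ^ card S * k ^ card (Basis - S)) * (\<integral>\<^sup>+x. h (dil S l k x) \<partial>lborel)"
proof -
  define c where "c j = (if j \<in> S then l else k)" for j :: 'a
  have dil_eq: "dil S l k = (\<lambda>x. 0 + (\<Sum>j\<in>Basis. (c j * (x \<bullet> j)) *\<^sub>R j))"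
    by (rule ext, rule euclidean_eqI)
      (use S in \<open>auto simp: dil_def inner_add_left inner_proj_Basis c_def inner_sum_left_Basis\<close>)
  have "(\<Prod>j\<in>Basis. \<bar>c j\<bar>) = (\<Prod>j\<in>Basis - S. \<bar>c j\<bar>) * (\<Prod>j\<in>S. \<bar>c j\<bar>)"
    by (rule prod.subset_diff[OF S]) simp
  also have "\<dots> = l ^ card S * k ^ card (Basis - S)"
    using assms by (simp add: c_def mult.commute)
  finally have c: "(\<Prod>j\<in>Basis. \<bar>c j\<bar>) = l ^ card S * k ^ card (Basis - S)" .
  have "(lborel :: 'a measure) = density (distr lborel borel (dil S l k)) (\<lambda>_. (\<Prod>j\<in>Basis. \<bar>c j\<bar>))"
    unfolding dil_eq by (rule lborel_affine_euclidean) (use assms in \<open>auto simp: c_def\<close>)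
  then have "(\<integral>\<^sup>+x. h x \<partial>lborel)
      = (\<integral>\<^sup>+x. h x \<partial>density (distr lborel borel (dil S l k)) (\<lambda>_. (\<Prod>j\<in>Basis. \<bar>c j\<bar>)))"
    by simp
  also have "\<dots> = ennreal (\<Prod>j\<in>Basis. \<bar>c j\<bar>) * (\<integral>\<^sup>+x. h (dil S l k x) \<partial>lborel)"
    by (simp add: nn_integral_density nn_integral_distr nn_integral_cmult)
  finally show ?thesis unfolding c .
qed

section \<open>Logarithmic polar coordinates\<close>

text \<open>A cross-section with thickness: every orbit off z = 0 stays in it for a set of
  parameters \<open>t\<close> of length exactly 1, so no surface measure has to be
  introduced.\<close>

definition shell :: "'a::euclidean_space set \<Rightarrow> 'a set" where
  "shell S = {x. 1 \<le> norm (proj S x) \<and> norm (proj S x) < exp 1}"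

lemma sets_shell [measurable]: "shell S \<in> sets borel"
  unfolding shell_def by measurable

text \<open>Integration in logarithmic polar coordinates: the orbits of the dilations of the
  \<open>S\<close>-coordinates replace the rays, and a shell of logarithmic width 1 replaces the sphere.\<close>

lemma nn_integral_polar:
  fixes F :: "'a::euclidean_space \<Rightarrow> ennreal"
  assumes S: "S \<subseteq> Basis" and F [measurable]: "F \<in> borel_measurable borel"
  shows "(\<integral>\<^sup>+x. F x * ennreal (norm (proj S x) powr - real (card S)) \<partial>lborel)
       = (\<integral>\<^sup>+x. indicator (shell S) x * ennreal (norm (proj S x) powr - real (card S)) *
            (\<integral>\<^sup>+t. F (dil S (exp t) 1 x) \<partial>lborel) \<partial>lborel)"
proof -
  define w where "w x = ennreal (norm (proj S x) powr - real (card S))" for x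
  have w [measurable]: "w \<in> borel_measurable borel" unfolding w_def by measurable
  have "(\<integral>\<^sup>+x. indicator (shell S) x * w x * (\<integral>\<^sup>+t. F (dil S (exp t) 1 x) \<partial>lborel) \<partial>lborel)
      = (\<integral>\<^sup>+x. \<integral>\<^sup>+t. indicator (shell S) x * w x * F (dil S (exp t) 1 x) \<partial>lborel \<partial>lborel)"
    by (intro nn_integral_cong nn_integral_cmult[symmetric]) measurable
  also have "\<dots> = (\<integral>\<^sup>+t. \<integral>\<^sup>+x. indicator (shell S) x * w x * F (dil S (exp t) 1 x) \<partial>lborel \<partial>lborel)"
    by (rule lborel_pair.Fubini'[symmetric]) measurable
  also have "\<dots> = (\<integral>\<^sup>+t. \<integral>\<^sup>+x. indicator (shell S) (dil S (exp (- t)) 1 x) * w x * F x \<partial>lborel \<partial>lborel)"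
  \<comment> \<open>For fixed \<open>t\<close> the dilation is substituted in the
    \<open>x\<close>-integral; its Jacobian \<open>exp t ^ card S\<close> cancels against the
    scaling of \<open>w\<close>.\<close>
  proof (rule nn_integral_cong)
    fix t :: real
    define h where "h y = indicator (shell S) (dil S (exp (- t)) 1 y) * w (dil S (exp (- t)) 1 y) * F y" for y
    have [measurable]: "h \<in> borel_measurable borel" unfolding h_def by measurable
    have e: "exp t ^ card S * 1 ^ card (Basis - S) = exp t powr real (card S)"
      by (simp add: powr_realpow)
    have w_dil: "w (dil S (exp (- t)) 1 y) = ennreal (exp t powr real (card S)) * w y" for y
    proof -
      have "exp (- t) powr (- real (card S)) = exp t powr real (card S)"
        by (simp add: powr_def)
      then show ?thesis unfolding w_def
        by (simp add: proj_dil[OF S] powr_mult ennreal_mult)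
    qed
    have "(\<integral>\<^sup>+x. indicator (shell S) x * w x * F (dil S (exp t) 1 x) \<partial>lborel)
        = (\<integral>\<^sup>+x. h (dil S (exp t) 1 x) \<partial>lborel)"
      by (simp add: h_def dil_dil[OF S] exp_minus S)
    also have "ennreal (exp t powr real (card S)) * \<dots> = (\<integral>\<^sup>+x. h x \<partial>lborel)"
      using nn_integral_dil[OF S, of h "exp t" 1] by (simp add: e powr_realpow)
    also have "\<dots> = ennreal (exp t powr real (card S)) *
        (\<integral>\<^sup>+x. indicator (shell S) (dil S (exp (- t)) 1 x) * w x * F x \<partial>lborel)"
      by (subst nn_integral_cmult[symmetric]) (auto simp: h_def w_dil mult_ac intro!: nn_integral_cong)
    finally show "(\<integral>\<^sup>+x. indicator (shell S) x * w x * F (dil S (exp t) 1 x) \<partial>lborel)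
        = (\<integral>\<^sup>+x. indicator (shell S) (dil S (exp (- t)) 1 x) * w x * F x \<partial>lborel)"
      by (simp add: ennreal_mult_cancel_left)
  qed
  also have "\<dots> = (\<integral>\<^sup>+x. \<integral>\<^sup>+t. indicator (shell S) (dil S (exp (- t)) 1 x) * w x * F x \<partial>lborel \<partial>lborel)"
    by (rule lborel_pair.Fubini') measurable
  also have "\<dots> = (\<integral>\<^sup>+x. F x * w x \<partial>lborel)"
  proof (rule nn_integral_cong)
    fix x
    have "(\<integral>\<^sup>+t. indicator (shell S) (dil S (exp (- t)) 1 x) * w x * F x \<partial>lborel)
        = (\<integral>\<^sup>+t. indicator (shell S) (dil S (exp (- t)) 1 x) \<partial>lborel) * (F x * w x)"
      by (subst nn_integral_multc[symmetric]) (auto simp: mult_ac)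
    also have "\<dots> = F x * w x"
    proof (cases "norm (proj S x) = 0")
      \<comment> \<open>The default \<open>0 powr _ = 0\<close> makes \<open>w\<close> vanish on the
        plane z = 0, so no null-set argument is required.\<close>
      case True
      then show ?thesis by (simp add: w_def)
    next
      case False
      define n where "n = norm (proj S x)"
      have n: "n > 0" using False by (simp add: n_def)
      have "dil S (exp (- t)) 1 x \<in> shell S \<longleftrightarrow> t \<in> {ln n - 1<..ln n}" for t
      proof -
        have "dil S (exp (- t)) 1 x \<in> shell S \<longleftrightarrow> 1 \<le> exp (- t) * n \<and> exp (- t) * n < exp 1"
          by (simp add: shell_def proj_dil[OF S] n_def)
        also have "exp (- t) * n = exp (ln n - t)" using n by (simp add: exp_diff exp_minus field_simps)
        finally show ?thesis by auto
      qed
      then have "(\<integral>\<^sup>+t. indicator (shell S) (dil S (exp (- t)) 1 x) \<partial>lborel)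
          = (\<integral>\<^sup>+t. indicator {ln n - 1<..ln n} t \<partial>lborel)"
        by (intro nn_integral_cong) (simp add: indicator_def)
      then show ?thesis by simp
    qed
    finally show "(\<integral>\<^sup>+t. indicator (shell S) (dil S (exp (- t)) 1 x) * w x * F x \<partial>lborel) = F x * w x" .
  qed
  finally show ?thesis by (simp add: w_def)
qed

subsection \<open>The inequality along dilations\<close>

text \<open>\<open>proj S\<close> generates the dilations, so differentiating \<open>u\<close> along
  an orbit gives the Euler derivative \<open>D x (proj S x)\<close>.\<close>

lemma dil_has_vector_derivative:
  assumes S: "S \<subseteq> Basis"
  shows "((\<lambda>t. dil S (exp t) 1 x) has_vector_derivative proj S (dil S (exp t) 1 x)) (at t)"
  unfolding proj_dil[OF S] unfolding dil_def
  by (auto intro!: derivative_eq_intros)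

text \<open>On the orbit through \<open>x\<close>, ln |z| equals \<open>t + ln n\<close>, so the
  weights are those of the one-dimensional inequality with \<rho> shifted by \<open>ln n\<close>.
  Since both sides decompose with the same nonnegative density on the shell, the orbitwise
  inequality suffices.\<close>

lemma hardy_dilation:
  fixes u :: "'a::euclidean_space \<Rightarrow> real" and D :: "'a \<Rightarrow> 'a \<Rightarrow>\<^sub>L real"
  assumes S: "S \<subseteq> Basis" and p: "p > 1"
    and u: "\<And>x. (u has_derivative blinfun_apply (D x)) (at x)" "continuous_on UNIV D"
    and \<rho>: "\<And>t. t \<le> d \<Longrightarrow> (\<rho> has_real_derivative \<rho>' t) (at t)" "continuous_on {..d} \<rho>'"
           "\<And>t. t \<le> d \<Longrightarrow> \<rho>' t > 0"
    and meas [measurable]: "\<rho> \<in> borel_measurable borel" "\<rho>' \<in> borel_measurable borel"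
    and supp: "\<And>x. u x \<noteq> 0 \<Longrightarrow> norm (proj S x) < exp d"
              "a < 0 \<Longrightarrow> \<exists>c. \<forall>x. u x \<noteq> 0 \<longrightarrow> exp c < norm (proj S x)"
  shows "(\<integral>\<^sup>+x. ennreal (\<bar>a\<bar> powr p * (\<bar>u x\<bar> powr p *
            (exp (p * a * \<rho> (ln (norm (proj S x)))) * \<rho>' (ln (norm (proj S x))))))
            * indicator {x. 0 < norm (proj S x) \<and> norm (proj S x) \<le> exp d} x
            * ennreal (norm (proj S x) powr - real (card S)) \<partial>lborel)
       \<le> (\<integral>\<^sup>+x. ennreal (\<bar>D x (proj S x)\<bar> powr p *
            (exp (p * a * \<rho> (ln (norm (proj S x)))) * \<rho>' (ln (norm (proj S x))) powr (1 - p)))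
            * indicator {x. 0 < norm (proj S x) \<and> norm (proj S x) \<le> exp d} x
            * ennreal (norm (proj S x) powr - real (card S)) \<partial>lborel)"
    (is "(\<integral>\<^sup>+x. ?P x * _ \<partial>lborel) \<le> (\<integral>\<^sup>+x. ?Q x * _ \<partial>lborel)")
proof -
  have contu: "continuous_on UNIV u"
    using u(1) by (meson continuous_at_imp_continuous_on has_derivative_continuous)
  have [measurable]: "u \<in> borel_measurable borel"
    by (rule borel_measurable_continuous_onI[OF contu])
  have contDz: "continuous_on UNIV (\<lambda>x. D x (proj S x))"
    by (intro blinfun.continuous_on u(2) continuous_intros)
  have [measurable]: "(\<lambda>x. D x (proj S x)) \<in> borel_measurable borel"
    by (rule borel_measurable_continuous_onI[OF contDz])
  have mP: "?P \<in> borel_measurable borel" and mQ: "?Q \<in> borel_measurable borel"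
    by measurable
  show ?thesis
    unfolding nn_integral_polar[OF S mP] nn_integral_polar[OF S mQ]
  proof (intro nn_integral_mono)
    fix x
    define n where "n = norm (proj S x)"
    define \<delta> where "\<delta> t = dil S (exp t) 1 x" for t
    have "(\<integral>\<^sup>+t. ?P (\<delta> t) \<partial>lborel) \<le> (\<integral>\<^sup>+t. ?Q (\<delta> t) \<partial>lborel)" if "x \<in> shell S"
    proof -
      have n: "n > 0" using that by (auto simp: shell_def n_def)
      have Z: "norm (proj S (\<delta> t)) = exp (t + ln n)" for t
        using n by (simp add: \<delta>_def proj_dil[OF S] n_def exp_add)
      define f' where "f' t = D (\<delta> t) (proj S (\<delta> t))" for t
      have ind: "indicator {x. 0 < norm (proj S x) \<and> norm (proj S x) \<le> exp d} (\<delta> t)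
          = (indicator {..d - ln n} t :: ennreal)" for t
      proof -
        have "0 < norm (proj S (\<delta> t)) \<and> norm (proj S (\<delta> t)) \<le> exp d \<longleftrightarrow> t \<le> d - ln n"
          unfolding Z by auto
        then show ?thesis by (simp add: indicator_def)
      qed
      have "(\<integral>\<^sup>+t\<in>{..d - ln n}. ennreal (\<bar>a\<bar> powr p * (\<bar>u (\<delta> t)\<bar> powr p *
              (exp (p * a * \<rho> (t + ln n)) * \<rho>' (t + ln n)))) \<partial>lborel)
         \<le> (\<integral>\<^sup>+t\<in>{..d - ln n}. ennreal (\<bar>f' t\<bar> powr p *
              (exp (p * a * \<rho> (t + ln n)) * \<rho>' (t + ln n) powr (1 - p))) \<partial>lborel)"
      proof (rule hardy_half_line[OF p])
        show "((\<lambda>t. u (\<delta> t)) has_real_derivative f' t) (at t)" for t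
        proof -
          have "(\<delta> has_vector_derivative proj S (\<delta> t)) (at t)"
            unfolding \<delta>_def by (rule dil_has_vector_derivative[OF S])
          from vector_derivative_diff_chain_within[OF this has_derivative_at_withinI[OF u(1)]]
          show ?thesis
            by (simp add: f'_def o_def has_real_derivative_iff_has_vector_derivative)
        qed
        have "continuous_on UNIV \<delta>"
          unfolding \<delta>_def dil_def by (intro continuous_intros)
        then show "continuous_on UNIV f'"
          unfolding f'_def by (rule continuous_on_compose2[OF contDz]) auto
        show "((\<lambda>t. \<rho> (t + ln n)) has_real_derivative \<rho>' (t + ln n)) (at t)" if "t \<le> d - ln n" for t
          using \<rho>(1)[of "t + ln n"] that by (simp add: DERIV_shift)
        show "continuous_on {..d - ln n} (\<lambda>t. \<rho>' (t + ln n))"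
          by (rule continuous_on_compose2[OF \<rho>(2)]) (auto intro!: continuous_intros)
        show "\<rho>' (t + ln n) > 0" if "t \<le> d - ln n" for t
          using \<rho>(3)[of "t + ln n"] that by simp
        show "u (\<delta> t) = 0" if "t \<ge> d - ln n" for t
          using supp(1)[of "\<delta> t"] that by (auto simp: Z)
        show "\<exists>c. \<forall>t\<le>c. u (\<delta> t) = 0" if neg: "a < 0"
        proof -
          obtain c where c: "u x \<noteq> 0 \<Longrightarrow> exp c < norm (proj S x)" for x
            using supp(2)[OF neg] by auto
          show ?thesis
            by (rule exI[of _ "c - ln n"]) (use c[of "\<delta> _"] in \<open>force simp: Z\<close>)
        qed
      qed
      then show ?thesis unfolding ind by (simp add: Z f'_def)
    qed
    then show "indicator (shell S) x * ennreal (norm (proj S x) powr - real (card S)) *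
            (\<integral>\<^sup>+t. ?P (dil S (exp t) 1 x) \<partial>lborel)
       \<le> indicator (shell S) x * ennreal (norm (proj S x) powr - real (card S)) *
            (\<integral>\<^sup>+t. ?Q (dil S (exp t) 1 x) \<partial>lborel)"
      by (cases "x \<in> shell S") (auto intro!: mult_left_mono simp: \<delta>_def)
  qed
qed

section \<open>Radial integrands and volumes of cross-sections\<close>

definition shell_vol :: "'a::euclidean_space set \<Rightarrow> real \<Rightarrow> ennreal" where
  "shell_vol S r = (\<integral>\<^sup>+x. indicator (shell S) x * ennreal (norm (proj S x) powr - real (card S)) *
     indicator {x. norm (proj (Basis - S) x) < r} x \<partial>lborel)"

text \<open>Orbits keep the remaining coordinates fixed, so the indicator is constant along each of
  them, and translation invariance in \<open>t\<close> removes the dependence on the starting point.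
  The integral factors.\<close>

lemma nn_integral_radial:
  fixes H :: "real \<Rightarrow> ennreal"
  assumes S: "S \<subseteq> (Basis :: 'a::euclidean_space set)" and H [measurable]: "H \<in> borel_measurable borel"
  shows "(\<integral>\<^sup>+x. H (ln (norm (proj S x))) * indicator {x. norm (proj (Basis - S) x) < r} x
            * ennreal (norm (proj S x) powr - real (card S)) \<partial>lborel)
       = shell_vol S r * (\<integral>\<^sup>+t. H t \<partial>lborel)"
proof -
  have "(\<integral>\<^sup>+t. H (ln (norm (proj S (dil S (exp t) 1 x))))
          * indicator {x. norm (proj (Basis - S) x) < r} (dil S (exp t) 1 x) \<partial>lborel)
      = indicator {x. norm (proj (Basis - S) x) < r} x * (\<integral>\<^sup>+t. H t \<partial>lborel)" if "x \<in> shell S" for x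
  proof -
    define n where "n = norm (proj S x)"
    have n: "n > 0" using that by (auto simp: shell_def n_def)
    have Z: "ln (norm (proj S (dil S (exp t) 1 x))) = ln n + 1 * t" for t
      using n by (simp add: proj_dil[OF S] n_def ln_mult)
    have "indicator {x. norm (proj (Basis - S) x) < r} (dil S (exp t) 1 x)
        = (indicator {x. norm (proj (Basis - S) x) < r} x :: ennreal)" for t
      by (simp add: indicator_def proj_dil[OF S])
    then show ?thesis
      using nn_integral_real_affine[OF H, of 1 "ln n"]
      by (simp add: Z nn_integral_multc mult.commute)
  qed
  then have *: "indicator (shell S) x * w * (\<integral>\<^sup>+t. H (ln (norm (proj S (dil S (exp t) 1 x))))
          * indicator {x. norm (proj (Basis - S) x) < r} (dil S (exp t) 1 x) \<partial>lborel)
      = indicator (shell S) x * w * indicator {x. norm (proj (Basis - S) x) < r} x * (\<integral>\<^sup>+t. H t \<partial>lborel)" for x w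
    by (cases "x \<in> shell S") (simp_all add: mult_ac)
  show ?thesis
    by (subst nn_integral_polar[OF S]) (simp_all add: * shell_vol_def nn_integral_multc)
qed

text \<open>Dilating only the remaining coordinates leaves the shell and its weight unchanged. Two
  radii with ratio close to 1 therefore give volumes with ratio close to 1.\<close>

lemma shell_vol_scale:
  assumes S: "S \<subseteq> (Basis :: 'a::euclidean_space set)" and l: "l > 0"
  shows "shell_vol S (l * r) = ennreal (l ^ card (Basis - S)) * shell_vol S r"
  unfolding shell_vol_def
  by (subst nn_integral_dil[OF S _ zero_less_one l])
    (use l in \<open>simp_all add: proj_dil[OF S] shell_def indicator_def\<close>)

text \<open>On the shell |z| >= 1, so the weight is at most 1 on a bounded set. Finiteness and
  positivity of this volume are what allow a strict inequality between the final integrals.\<close>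

lemma shell_vol_finite:
  assumes S: "S \<subseteq> (Basis :: 'a::euclidean_space set)"
  shows "shell_vol S r < \<infinity>"
proof -
  have "shell_vol S r \<le> (\<integral>\<^sup>+x. indicator (cball 0 (exp 1 + \<bar>r\<bar>)) x \<partial>(lborel :: 'a measure))"
    unfolding shell_vol_def
  proof (rule nn_integral_mono)
    fix x :: 'a
    show "indicator (shell S) x * ennreal (norm (proj S x) powr - real (card S)) *
        indicator {x. norm (proj (Basis - S) x) < r} x \<le> indicator (cball 0 (exp 1 + \<bar>r\<bar>)) x"
    proof (cases "x \<in> shell S \<and> norm (proj (Basis - S) x) < r")
      case True
      have "norm x \<le> norm (proj S x) + norm (proj (Basis - S) x)"
        using norm_triangle_ineq[of "proj S x" "proj (Basis - S) x"] by (simp add: proj_compl[OF S])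
      then have "norm x \<le> exp 1 + \<bar>r\<bar>" using True by (auto simp: shell_def)
      moreover have "norm (proj S x) powr - real (card S) \<le> 1"
        using True by (auto simp: shell_def powr_minus_divide intro!: divide_le_eq_1[THEN iffD2] ge_one_powr_ge_zero)
      ultimately show ?thesis using True by (simp add: ennreal_le_1)
    qed auto
  qed
  also have "\<dots> = emeasure (lborel :: 'a measure) (cball 0 (exp 1 + \<bar>r\<bar>))" by simp
  also have "\<dots> < \<infinity>" by (rule emeasure_bounded_finite) simp
  finally show ?thesis .
qed

lemma shell_vol_pos:
  assumes S: "S \<subseteq> (Basis :: 'a::euclidean_space set)" "S \<noteq> {}" and r: "r > 0"
  shows "shell_vol S r > 0"
proof -
  define U where "U = {x :: 'a. 1 < norm (proj S x) \<and> norm (proj S x) < exp 1 \<and> norm (proj (Basis - S) x) < r}"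
  have "open U"
    unfolding U_def by (intro open_Collect_conj open_Collect_less continuous_intros)
  moreover have "U \<noteq> {}"
  proof -
    \<comment> \<open>The witness is 3/2 times a basis vector in \<open>S\<close>: its norm lies
      between 1 and e, and its remaining coordinates vanish.\<close>
    obtain b where b: "b \<in> S" using S by auto
    then have "proj S b = b"
      by (intro euclidean_eqI[of "proj S b"]) (use S in \<open>auto simp: inner_proj_Basis[OF S(1)] inner_Basis subset_iff\<close>)
    moreover have "norm b = 1" using b S by auto
    moreover have "3/2 < exp (1::real)" using exp_ge_add_one_self[of 1] by linarith
    ultimately have "(3/2) *\<^sub>R b \<in> U" using r
      by (simp add: U_def proj_compl[OF S(1)])
    then show ?thesis by auto
  qed
  ultimately obtain x e where e: "e > 0" "ball x e \<subseteq> U"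
    using open_contains_ball by blast
  have "emeasure lborel (ball x e) \<noteq> 0"
  proof
    assume "emeasure lborel (ball x e) = 0"
    then have "measure lborel (ball x e) = 0" unfolding measure_def by (simp only: enn2real_0)
    with content_ball_pos[OF e(1), of x] show False by (simp only: less_irrefl)
  qed
  then have "0 < emeasure lborel (ball x e)" by (simp add: zero_less_iff_neq_zero)
  also have "\<dots> \<le> emeasure lborel U"
    using e \<open>open U\<close> by (intro emeasure_mono) auto
  finally have U: "emeasure lborel U > 0" .
  show ?thesis
  proof (rule ccontr)
    assume "\<not> shell_vol S r > 0"
    then have "AE x in lborel. indicator (shell S) x * ennreal (norm (proj S x) powr - real (card S)) *
     indicator {x :: 'a. norm (proj (Basis - S) x) < r} x = 0"
      unfolding shell_vol_def by (subst nn_integral_0_iff_AE[symmetric]) (auto simp: not_less)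
    then have "AE x in lborel. x \<notin> U"
      by (rule AE_mp) (auto simp: U_def shell_def indicator_def)
    moreover have "U \<in> sets lborel" using \<open>open U\<close> by simp
    ultimately show False using U by (simp add: AE_iff_measurable[of U])
  qed
qed

subsection \<open>Cutoff functions\<close>

text \<open>A quadratic C^1 spline rising from 0 to 1 on [0,1]. Its derivative is the tent with peak
  2 at 1/2 and area 1. Truncated squares reduce differentiability at all three knots to a single
  lemma.\<close>

definition smooth_step :: "real \<Rightarrow> real" where
  "smooth_step x = 2 * (max 0 x)\<^sup>2 - 4 * (max 0 (x - 1/2))\<^sup>2 + 2 * (max 0 (x - 1))\<^sup>2"

definition smooth_step' :: "real \<Rightarrow> real" where
  "smooth_step' x = 4 * max 0 x - 8 * max 0 (x - 1/2) + 4 * max 0 (x - 1)"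

lemma has_real_derivative_max0_square:
  "((\<lambda>x. (max 0 x)\<^sup>2) has_real_derivative 2 * max 0 x) (at (x::real))"
proof -
  consider "x > 0" | "x < 0" | "x = 0" by linarith
  then show ?thesis
  proof cases
    case 1
    have "((\<lambda>x. x\<^sup>2) has_real_derivative 2 * x) (at x)"
      by (auto intro!: derivative_eq_intros)
    then have "((\<lambda>x. (max 0 x)\<^sup>2) has_real_derivative 2 * x) (at x)"
      by (rule has_field_derivative_transform_within_open[where S="{0<..}"]) (use 1 in auto)
    then show ?thesis using 1 by simp
  next
    case 2
    have "((\<lambda>x. 0) has_real_derivative 0) (at x)" by simp
    then have "((\<lambda>x. (max 0 x)\<^sup>2) has_real_derivative 0) (at x)"
      by (rule has_field_derivative_transform_within_open[where S="{..<0}"]) (use 2 in auto)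
    then show ?thesis using 2 by simp
  next
    case 3
    have "((\<lambda>h::real. max 0 h) \<longlongrightarrow> max 0 0) (at 0)"
      by (intro tendsto_intros)
    moreover have "\<forall>\<^sub>F h::real in at 0. max 0 h = (max 0 h)\<^sup>2 / h"
      by (rule eventually_at_filter[THEN iffD2, OF always_eventually]) (auto simp: max_def power2_eq_square)
    ultimately have "((\<lambda>h::real. (max 0 h)\<^sup>2 / h) \<longlongrightarrow> max 0 0) (at 0)"
      by (rule Lim_transform_eventually)
    then show ?thesis using 3 by (simp add: has_field_derivative_iff)
  qed
qed

lemma has_real_derivative_smooth_step:
  "(smooth_step has_real_derivative smooth_step' x) (at x)"
proof -
  have *: "((\<lambda>x. (max 0 (x - c))\<^sup>2) has_real_derivative 2 * max 0 (x - c)) (at x)" for c :: real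
    using DERIV_shift[of "\<lambda>x. (max 0 x)\<^sup>2" _ x "- c"] has_real_derivative_max0_square[of "x - c"] by simp
  show ?thesis
    unfolding smooth_step_def[abs_def] smooth_step'_def
    using DERIV_add[OF DERIV_diff[OF DERIV_cmult[OF *[of 0], of 2] DERIV_cmult[OF *[of "1/2"], of 4]]
        DERIV_cmult[OF *[of 1], of 2]]
    by (simp add: mult.assoc[symmetric])
qed

lemma continuous_on_smooth_step' [continuous_intros]:
  "continuous_on A f \<Longrightarrow> continuous_on A (\<lambda>x. smooth_step' (f x))"
  unfolding smooth_step'_def by (intro continuous_intros)

lemma continuous_on_smooth_step [continuous_intros]:
  "continuous_on A f \<Longrightarrow> continuous_on A (\<lambda>x. smooth_step (f x))"
  unfolding smooth_step_def by (intro continuous_intros)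

lemma smooth_step_eq_0: "x \<le> 0 \<Longrightarrow> smooth_step x = 0"
  and smooth_step'_eq_0: "x \<le> 0 \<Longrightarrow> smooth_step' x = 0"
  by (simp_all add: smooth_step_def smooth_step'_def max_def)

lemma smooth_step_eq_1: "x \<ge> 1 \<Longrightarrow> smooth_step x = 1"
  by (simp add: smooth_step_def max_def power2_eq_square algebra_simps)

lemma abs_smooth_step'_le: "\<bar>smooth_step' x\<bar> \<le> 2"
  by (auto simp: smooth_step'_def max_def)

lemma smooth_step_nonneg: "smooth_step x \<ge> 0"
  and smooth_step_le_1: "smooth_step x \<le> 1"
proof -
  consider "x \<le> 0" | "0 \<le> x" "x \<le> 1/2" | "1/2 \<le> x" "x \<le> 1" | "x \<ge> 1" by linarith
  then have "smooth_step x \<ge> 0 \<and> smooth_step x \<le> 1"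
  proof cases
    case 2
    then have "smooth_step x = 2 * x\<^sup>2" by (simp add: smooth_step_def max_def)
    moreover have "x\<^sup>2 \<le> (1/2)\<^sup>2" using 2 by (intro power_mono) auto
    ultimately show ?thesis by (simp add: power2_eq_square)
  next
    case 3
    then have "smooth_step x = 1 - 2 * (1 - x)\<^sup>2"
      by (auto simp: smooth_step_def max_def power2_eq_square algebra_simps)
    moreover have "(1 - x)\<^sup>2 \<le> (1/2)\<^sup>2" using 3 by (intro power_mono) auto
    ultimately show ?thesis by (simp add: power2_eq_square)
  qed (auto simp: smooth_step_eq_0 smooth_step_eq_1)
  then show "smooth_step x \<ge> 0" "smooth_step x \<le> 1" by auto
qed

text \<open>A bump on [c,d] with transition zones of width \<open>L\<close>; it is 1 between them.
  The product rule and the slope bound 2 for each factor give the derivative bound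
  \<open>4 / L\<close>.\<close>

definition plateau :: "real \<Rightarrow> real \<Rightarrow> real \<Rightarrow> real \<Rightarrow> real" where
  "plateau c d L x = smooth_step ((x - c) / L) * smooth_step ((d - x) / L)"

definition plateau' :: "real \<Rightarrow> real \<Rightarrow> real \<Rightarrow> real \<Rightarrow> real" where
  "plateau' c d L x = smooth_step' ((x - c) / L) / L * smooth_step ((d - x) / L)
     - smooth_step ((x - c) / L) * (smooth_step' ((d - x) / L) / L)"

lemma has_real_derivative_plateau:
  "(plateau c d L has_real_derivative plateau' c d L x) (at x)"
proof -
  have 1: "((\<lambda>x. smooth_step ((x - c) / L)) has_real_derivative smooth_step' ((x - c) / L) * (1 / L)) (at x)"
    by (rule DERIV_chain2[OF has_real_derivative_smooth_step DERIV_cdivide]) (auto intro!: derivative_eq_intros)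
  have 2: "((\<lambda>x. smooth_step ((d - x) / L)) has_real_derivative smooth_step' ((d - x) / L) * (- 1 / L)) (at x)"
    by (rule DERIV_chain2[OF has_real_derivative_smooth_step DERIV_cdivide]) (auto intro!: derivative_eq_intros)
  show ?thesis
    using DERIV_mult'[OF 1 2] unfolding plateau_def[abs_def] plateau'_def by (simp add: algebra_simps)
qed

lemma plateau_nonneg: "plateau c d L x \<ge> 0"
  and plateau_le_1: "plateau c d L x \<le> 1"
  unfolding plateau_def by (auto intro!: mult_nonneg_nonneg mult_le_one smooth_step_nonneg smooth_step_le_1)

lemma plateau_eq_0:
  assumes "L > 0" "x \<le> c \<or> d \<le> x"
  shows "plateau c d L x = 0" "plateau' c d L x = 0"
proof -
  have "(x - c) / L \<le> 0 \<or> (d - x) / L \<le> 0" using assms by (auto simp: divide_le_0_iff)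
  then show "plateau c d L x = 0" "plateau' c d L x = 0"
    by (auto simp: plateau_def plateau'_def smooth_step_eq_0 smooth_step'_eq_0)
qed

lemma plateau_eq_1: "L > 0 \<Longrightarrow> c + L \<le> x \<Longrightarrow> x \<le> d - L \<Longrightarrow> plateau c d L x = 1"
  by (simp add: plateau_def smooth_step_eq_1)

lemma abs_plateau'_le:
  assumes "L > 0"
  shows "\<bar>plateau' c d L x\<bar> \<le> 4 / L"
proof -
  have b: "\<bar>smooth_step' u / L * smooth_step v\<bar> \<le> 2 / L * 1" for u v
    unfolding abs_mult using assms abs_smooth_step'_le[of u] smooth_step_nonneg[of v] smooth_step_le_1[of v]
    by (intro mult_mono) (auto simp: divide_right_mono)
  have "\<bar>plateau' c d L x\<bar> \<le> \<bar>smooth_step' ((x - c) / L) / L * smooth_step ((d - x) / L)\<bar>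
      + \<bar>smooth_step' ((d - x) / L) / L * smooth_step ((x - c) / L)\<bar>"
    unfolding plateau'_def
    by (rule order_trans[OF abs_triangle_ineq4]) (simp add: mult.commute)
  then show ?thesis using b[of "(x - c) / L" "(d - x) / L"] b[of "(d - x) / L" "(x - c) / L"] by simp
qed

lemma nn_integral_deriv_Icc:
  fixes \<rho> \<rho>' :: "real \<Rightarrow> real"
  assumes "c \<le> d" "\<And>t. t \<in> {c..d} \<Longrightarrow> (\<rho> has_real_derivative \<rho>' t) (at t)"
    "\<And>t. t \<in> {c..d} \<Longrightarrow> \<rho>' t \<ge> 0" and [measurable]: "\<rho>' \<in> borel_measurable borel"
  shows "(\<integral>\<^sup>+t. ennreal (\<rho>' t) * indicator {c..d} t \<partial>lborel) = ennreal (\<rho> d - \<rho> c)"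
  by (rule nn_integral_FTC_Icc) (use assms in \<open>auto intro: DERIV_subset
      simp: has_real_derivative_iff_has_vector_derivative[symmetric]\<close>)

text \<open>By continuity at \<eta> = 0. The budget anticipates four losses: one \<eta> for the
  slope of the plateau and one for derivatives in the remaining coordinates; one factor 1 + \<eta>
  for the ratio of cylinder volumes and one for the ratio of \<rho>-lengths.\<close>

lemma exists_small_slack:
  fixes A p C :: real
  assumes "p > 1" "A \<ge> 0" "C > A powr p"
  shows "\<exists>\<eta>>0. (A + 2 * \<eta>) powr p * (1 + \<eta>)\<^sup>2 < C"
proof -
  have "((\<lambda>\<eta>. (A + 2 * \<eta>) powr p * (1 + \<eta>)\<^sup>2) \<longlongrightarrow> (A + 2 * 0) powr p * (1 + 0)\<^sup>2) (at_right 0)"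
    using assms by (intro tendsto_intros tendsto_powr2 eventually_at_rightI[of 0 1]) auto
  then have "\<forall>\<^sub>F \<eta> in at_right 0. (A + 2 * \<eta>) powr p * (1 + \<eta>)\<^sup>2 < C"
    by (rule order_tendstoD) (use assms in simp)
  then show ?thesis
    using eventually_happens[OF eventually_conj[OF eventually_at_right_less]] by force
qed

lemma exists_near_1_power_less:
  assumes "\<eta> > (0::real)"
  shows "\<exists>l>1. l ^ k \<le> 1 + \<eta>"
proof -
  have "((\<lambda>l::real. l ^ k) \<longlongrightarrow> 1 ^ k) (at_right 1)" by (intro tendsto_intros)
  then have "\<forall>\<^sub>F l in at_right (1::real). l ^ k < 1 + \<eta>"
    by (rule order_tendstoD) (use assms in simp)
  then show ?thesis
    using eventually_happens[OF eventually_conj[OF eventually_at_right_less]] by force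
qed

subsection \<open>Near-extremal functions\<close>

text \<open>The near-extremals are \<open>exp (- a * \<rho>)\<close>, cut off on a long \<open>\<rho>\<close>-interval and multiplied by a
  cutoff in the remaining coordinates. Pushing the support towards \<open>proj S x = 0\<close> makes the
  derivatives in the remaining coordinates negligible.\<close>

lemma sharp_dilation:
  fixes S :: "'a::euclidean_space set" and p a r0 K C t0 :: real and \<rho> \<rho>' :: "real \<Rightarrow> real"
  assumes S: "S \<subseteq> Basis" "S \<noteq> {}" and p: "p > 1" and r0: "r0 > 0" and K: "K \<ge> 0"
    and C: "C > \<bar>a\<bar> powr p"
    and \<rho>: "\<And>t. t \<le> t0 \<Longrightarrow> (\<rho> has_real_derivative \<rho>' t) (at t)" "continuous_on {..t0} \<rho>'"
           "\<And>t. t \<le> t0 \<Longrightarrow> \<rho>' t > 0"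
    and lim: "filterlim \<rho> at_bot at_bot" "((\<lambda>t. exp t / \<rho>' t) \<longlongrightarrow> 0) at_bot"
    and meas [measurable]: "\<rho> \<in> borel_measurable borel" "\<rho>' \<in> borel_measurable borel"
  obtains g g' h h' :: "real \<Rightarrow> real" and t1 t2 r :: real
  where "\<forall>y. (g has_real_derivative g' y) (at y)" "continuous_on UNIV g'"
    and "\<forall>y. (h has_real_derivative h' y) (at y)" "continuous_on UNIV h'"
    and "t1 \<le> t2" "t2 < t0" "0 < r" "r < r0"
    and "\<forall>y. y < exp (2 * t1) \<or> exp (2 * t2) < y \<longrightarrow> g y = 0 \<and> g' y = 0"
    and "\<forall>y\<ge>r\<^sup>2. h y = 0 \<and> h' y = 0"
    and "\<forall>B. (\<forall>x. 0 \<le> B x \<and> B x \<le> 2 * norm (proj S x)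
                 * \<bar>g' ((norm (proj S x))\<^sup>2) * h ((norm (proj (Basis - S) x))\<^sup>2)\<bar>
              + K * (2 * norm (proj (Basis - S) x))
                 * \<bar>g ((norm (proj S x))\<^sup>2) * h' ((norm (proj (Basis - S) x))\<^sup>2)\<bar>) \<longrightarrow>
          (\<integral>\<^sup>+x. ennreal ((B x * norm (proj S x)) powr p
              * (exp (p * a * \<rho> (ln (norm (proj S x)))) * \<rho>' (ln (norm (proj S x))) powr (1 - p)))
            * ennreal (norm (proj S x) powr - real (card S)) \<partial>lborel)
        < ennreal C * (\<integral>\<^sup>+x. ennreal (\<bar>g ((norm (proj S x))\<^sup>2) * h ((norm (proj (Basis - S) x))\<^sup>2)\<bar> powr p
              * (exp (p * a * \<rho> (ln (norm (proj S x)))) * \<rho>' (ln (norm (proj S x)))))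
            * ennreal (norm (proj S x) powr - real (card S)) \<partial>lborel)"
proof -
  let ?Z = "\<lambda>x. norm (proj S x)" and ?V = "\<lambda>x. norm (proj (Basis - S) x)"
  obtain \<eta> where \<eta>: "\<eta> > 0" "(\<bar>a\<bar> + 2 * \<eta>) powr p * (1 + \<eta>)\<^sup>2 < C"
    using exists_small_slack[OF p _ C] by auto
  obtain l where l: "l > 1" "l ^ card (Basis - S) \<le> 1 + \<eta>"
    using exists_near_1_power_less[OF \<eta>(1)] by blast
  \<comment> \<open>\<open>L\<close> makes the slope bound \<open>4 / L\<close> of the plateau equal
    to \<eta>; \<open>l0\<close>, the length of the plateau proper, is so large that the two
    transition zones amount to the fraction \<eta> of it.\<close>
  define L where "L = 4 / \<eta>"
  define l0 where "l0 = 2 * L / \<eta>"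
  have L: "L > 0" "4 / L = \<eta>" using \<eta> by (auto simp: L_def)
  have l0: "l0 > 0" "l0 + 2 * L = (1 + \<eta>) * l0" using \<eta> L by (auto simp: l0_def field_simps)
  define r where "r = r0 / 2"
  \<comment> \<open>The cutoff \<open>h\<close> is 1 on the cylinder of radius \<open>r1\<close> and
    supported in that of radius \<open>r = l * r1\<close>; the choice of \<open>l\<close> bounds the
    volume ratio by 1 + \<eta>.\<close>
  define r1 where "r1 = r / l"
  have r: "0 < r" "r < r0" "0 < r1" "r1 < r" "r = l * r1"
    using r0 l by (auto simp: r_def r1_def field_simps)
  define q where "q = r\<^sup>2 - r1\<^sup>2"
  have q: "q > 0" using r by (simp add: q_def power_strict_mono)
  \<comment> \<open>The argument will be a squared norm, which avoids the singularity of the norm at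
    the origin.\<close>
  define h where "h y = smooth_step ((r\<^sup>2 - y) / q)" for y
  define h' where "h' y = - smooth_step' ((r\<^sup>2 - y) / q) / q" for y
  have h_deriv: "(h has_real_derivative h' y) (at y)" for y
    unfolding h_def[abs_def] h'_def
    using DERIV_chain2[OF has_real_derivative_smooth_step DERIV_cdivide[where c=q, OF DERIV_diff[OF DERIV_const DERIV_ident]]]
    by simp
  have h'_cont: "continuous_on UNIV h'"
    unfolding h'_def using q by (intro continuous_intros) auto
  have h_0: "h y = 0 \<and> h' y = 0" if "y \<ge> r\<^sup>2" for y
    using that q by (simp add: h_def h'_def smooth_step_eq_0 smooth_step'_eq_0 divide_le_0_iff)
  have h_1: "h y = 1" if "y \<le> r1\<^sup>2" for y
    using that q by (simp add: h_def smooth_step_eq_1 q_def)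
  have h_bounds: "0 \<le> h y" "h y \<le> 1" for y
    by (simp_all add: h_def smooth_step_nonneg smooth_step_le_1)
  have h'_bound: "\<bar>h' y\<bar> \<le> 2 / q" for y
    using q abs_smooth_step'_le[of "(r\<^sup>2 - y) / q"] by (simp add: h'_def divide_right_mono)
  define K' where "K' = K * (2 * r) * (2 / q)"
  have K': "K' \<ge> 0" using K r q by (simp add: K'_def)
  have "((\<lambda>t. K' * (exp t / \<rho>' t)) \<longlongrightarrow> K' * 0) at_bot" by (intro tendsto_intros lim)
  then have "\<forall>\<^sub>F t in at_bot. K' * (exp t / \<rho>' t) < \<eta>"
    by (rule order_tendstoD) (use \<eta> in simp)
  then obtain T where T: "K' * (exp t / \<rho>' t) < \<eta>" if "t \<le> T" for t
    unfolding eventually_at_bot_linorder by blast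
  \<comment> \<open>\<eta>, \<open>L\<close>, \<open>l0\<close> and the radii are fixed by now; only
    the position of the interval is free. Moving it left affects neither cylinder volumes nor
    \<rho>-lengths, but makes the error \<open>K' * (exp t / \<rho>' t)\<close> smaller than
    \<eta>.\<close>
  define t2 where "t2 = min T (t0 - 1)"
  have t2: "t2 \<le> T" "t2 < t0" by (auto simp: t2_def)
  have \<rho>_mono: "\<rho> s < \<rho> t" if "s < t" "t \<le> t0" for s t
    by (rule DERIV_pos_imp_increasing[OF that(1)]) (use \<rho>(1,3) that in \<open>meson order_trans\<close>)
  have \<rho>_le_iff: "\<rho> s \<le> \<rho> t \<longleftrightarrow> s \<le> t" if "s \<le> t0" "t \<le> t0" for s t
    using \<rho>_mono[of s t] \<rho>_mono[of t s] that by (cases s t rule: linorder_cases) auto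
  have cont\<rho>: "continuous_on {..t0} \<rho>"
    using \<rho>(1) by (meson atMost_iff continuous_at_imp_continuous_on DERIV_isCont)
  \<comment> \<open>The endpoints are prescribed in the variable \<rho>. Divergence to minus
    infinity leaves room for an interval of any \<rho>-length, and the intermediate value theorem
    pulls its endpoints back to \<open>t\<close>.\<close>
  have \<rho>_surj: "\<exists>t\<le>t0. \<rho> t = y" if "y \<le> \<rho> t0" for y
  proof -
    have "\<forall>\<^sub>F t in at_bot. \<rho> t \<le> y" using lim(1) by (simp add: filterlim_at_bot)
    then obtain s where s: "s \<le> t0" "\<rho> s \<le> y"
      unfolding eventually_at_bot_linorder by (metis min.cobounded1 min.cobounded2)
    from IVT'[of \<rho> s y t0] s that show ?thesis
      using continuous_on_subset[OF cont\<rho>, of "{s..t0}"] by auto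
  qed
  define y2 where "y2 = \<rho> t2"
  define y1 where "y1 = y2 - (l0 + 2 * L)"
  have y2_le: "y2 \<le> \<rho> t0" using t2 \<rho>_le_iff[of t2 t0] by (simp add: y2_def)
  obtain t1 where t1: "t1 \<le> t0" "\<rho> t1 = y1" using \<rho>_surj[of y1] y2_le L l0 by (auto simp: y1_def)
  obtain s1 where s1: "s1 \<le> t0" "\<rho> s1 = y1 + L" using \<rho>_surj[of "y1 + L"] y2_le L l0 by (auto simp: y1_def)
  obtain s2 where s2: "s2 \<le> t0" "\<rho> s2 = y2 - L" using \<rho>_surj[of "y2 - L"] y2_le L l0 by (auto simp: y1_def)
  have ord: "t1 \<le> s1" "s1 \<le> s2" "s2 \<le> t2" "t1 \<le> t2"
    using \<rho>_le_iff[of t1 s1] \<rho>_le_iff[of s1 s2] \<rho>_le_iff[of s2 t2] \<rho>_le_iff[of t1 t2] t1 s1 s2 t2 L(1) l0(1)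
    unfolding y1_def y2_def[symmetric] by auto
  define \<phi> where "\<phi> t = exp (- a * \<rho> t) * plateau y1 y2 L (\<rho> t)" for t
  define \<phi>' where "\<phi>' t = exp (- a * \<rho> t) * \<rho>' t * (plateau' y1 y2 L (\<rho> t) - a * plateau y1 y2 L (\<rho> t))" for t
  have \<phi>_deriv: "(\<phi> has_real_derivative \<phi>' t) (at t)" if "t \<le> t0" for t
  proof -
    have 1: "((\<lambda>t. exp (- a * \<rho> t)) has_real_derivative exp (- a * \<rho> t) * (- a * \<rho>' t)) (at t)"
      by (rule DERIV_chain2[OF DERIV_exp DERIV_cmult[OF \<rho>(1)[OF that]]])
    have 2: "((\<lambda>t. plateau y1 y2 L (\<rho> t)) has_real_derivative plateau' y1 y2 L (\<rho> t) * \<rho>' t) (at t)"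
      by (rule DERIV_chain2[OF has_real_derivative_plateau \<rho>(1)[OF that]])
    show ?thesis using DERIV_mult'[OF 1 2] unfolding \<phi>_def \<phi>'_def by (simp add: algebra_simps)
  qed
  have \<phi>'_cont: "continuous_on {..t0} \<phi>'"
    unfolding \<phi>'_def plateau_def plateau'_def using L
    by (intro continuous_intros cont\<rho> \<rho>(2)) auto
  have \<phi>_0: "\<phi> t = 0 \<and> \<phi>' t = 0" if "t \<le> t1 \<or> t2 \<le> t" "t \<le> t0" for t
  proof -
    have "\<rho> t \<le> y1 \<or> y2 \<le> \<rho> t"
      using that t1 t2 by (auto simp: y2_def \<rho>_le_iff simp flip: t1(2))
    then show ?thesis using plateau_eq_0[OF L(1)] by (simp add: \<phi>_def \<phi>'_def)
  qed
  \<comment> \<open>The profile \<open>\<phi>\<close>, given in t = ln |z|, is rewritten in y =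
    |z|^2, so that t = ln y / 2.\<close>
  define g where "g y = (if 0 < y \<and> y < exp (2 * t0) then \<phi> (ln y / 2) else 0)" for y
  define g' where "g' y = (if 0 < y \<and> y < exp (2 * t0) then \<phi>' (ln y / 2) / (2 * y) else 0)" for y
  have g_0: "g y = 0 \<and> g' y = 0" if "y < exp (2 * t1) \<or> exp (2 * t2) < y" for y
  proof (cases "0 < y \<and> y < exp (2 * t0)")
    case True
    then have "y = exp (2 * (ln y / 2))" by simp
    then obtain s where s: "y = exp (2 * s)" by blast
    then have "s \<le> t1 \<or> t2 \<le> s" "s \<le> t0"
      using that True by auto
    then show ?thesis using \<phi>_0[of s] by (simp add: g_def g'_def s)
  qed (auto simp: g_def g'_def)
  \<comment> \<open>Two overlapping open sets cover the line: on \<open>U\<close> the formula with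
    the logarithm is smooth, on \<open>W\<close> the function is identically zero. Differentiability
    and continuity are checked on each.\<close>
  define U where "U = {0<..<exp (2 * t0)}"
  define W where "W = {..<exp (2 * t1)} \<union> {exp (2 * t2)<..}"
  have UW: "U \<union> W = UNIV"
  proof -
    have "y \<in> U" if "y \<notin> W" for y
    proof -
      have "exp (2 * t1) \<le> y" "y \<le> exp (2 * t2)" using that by (auto simp: W_def)
      moreover have "exp (2 * t2) < exp (2 * t0)" "0 < exp (2 * t1)" using t2 by auto
      ultimately have "0 < y" "y < exp (2 * t0)" by linarith+
      then show ?thesis by (simp add: U_def)
    qed
    then show ?thesis by blast
  qed
  have openUW: "open U" "open W" by (auto simp: U_def W_def)
  have lnU: "ln y / 2 \<le> t0" if "y \<in> U" for y
  proof -
    have "y > 0" "y < exp (2 * t0)" using that by (auto simp: U_def)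
    then have "ln y < ln (exp (2 * t0))" by (subst ln_less_cancel_iff) auto
    then show ?thesis by simp
  qed
  have g_deriv: "(g has_real_derivative g' y) (at y)" for y
  proof (cases "y \<in> U")
    case True
    have "((\<lambda>y. \<phi> (ln y / 2)) has_real_derivative \<phi>' (ln y / 2) * (1 / y / 2)) (at y)"
    proof (rule DERIV_chain2[where f=\<phi> and g="\<lambda>y. ln y / 2", OF \<phi>_deriv[OF lnU[OF True]]])
      show "((\<lambda>y. ln y / 2) has_real_derivative 1 / y / 2) (at y)"
        using True by (auto simp: U_def intro!: derivative_eq_intros)
    qed
    then have "(g has_real_derivative \<phi>' (ln y / 2) * (1 / y / 2)) (at y)"
      by (rule has_field_derivative_transform_within_open[OF _ openUW(1) True]) (simp add: g_def U_def)
    then show ?thesis using True by (simp add: g'_def U_def mult.commute)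
  next
    case False
    then have "y \<in> W" using UW by blast
    have "((\<lambda>y. 0) has_real_derivative 0) (at y)" by simp
    then have "(g has_real_derivative 0) (at y)"
      by (rule has_field_derivative_transform_within_open[OF _ openUW(2) \<open>y \<in> W\<close>]) (use g_0 in \<open>auto simp: W_def\<close>)
    then show ?thesis using \<open>y \<in> W\<close> g_0[of y] by (simp add: W_def)
  qed
  have g'_cont: "continuous_on UNIV g'"
  proof -
    have "continuous_on U (\<lambda>y. \<phi>' (ln y / 2) / (2 * y))"
      by (intro continuous_intros continuous_on_compose2[OF \<phi>'_cont]) (use lnU in \<open>auto simp: U_def\<close>)
    then have "continuous_on U g'" by (rule continuous_on_eq) (simp add: g'_def U_def)
    moreover have "continuous_on W g'"
      by (rule continuous_on_eq[OF continuous_on_const[of W 0]]) (use g_0 in \<open>auto simp: W_def\<close>)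
    ultimately have "continuous_on (U \<union> W) g'"
      by (rule continuous_on_open_Un[OF openUW])
    then show ?thesis by (simp add: UW)
  qed
  show thesis
  proof (rule that[OF _ g'_cont _ h'_cont ord(4) t2(2) r(1,2)])
    show "\<forall>y. (g has_real_derivative g' y) (at y)" "\<forall>y. (h has_real_derivative h' y) (at y)"
      using g_deriv h_deriv by auto
    show "\<forall>y. y < exp (2 * t1) \<or> exp (2 * t2) < y \<longrightarrow> g y = 0 \<and> g' y = 0"
      "\<forall>y\<ge>r\<^sup>2. h y = 0 \<and> h' y = 0"
      using g_0 h_0 by auto
  next
    {
    fix B :: "'a \<Rightarrow> real"
    assume B: "\<forall>x. 0 \<le> B x \<and> B x \<le> 2 * ?Z x * \<bar>g' ((?Z x)\<^sup>2) * h ((?V x)\<^sup>2)\<bar>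
              + K * (2 * ?V x) * \<bar>g ((?Z x)\<^sup>2) * h' ((?V x)\<^sup>2)\<bar>"
    let ?w = "\<lambda>x. ennreal (?Z x powr - real (card S))"
    let ?A = "(\<bar>a\<bar> + 2 * \<eta>) powr p"
    \<comment> \<open>The density of \<rho>-length: once the weights have cancelled, both integrands
      are compared with it.\<close>
    define H where "H c d t = ennreal (\<rho>' t) * indicator {c..d} t" for c d t :: real
    have [measurable]: "H c d \<in> borel_measurable borel" for c d unfolding H_def by measurable
    have H_int: "(\<integral>\<^sup>+t. H c d t \<partial>lborel) = ennreal (\<rho> d - \<rho> c)" if "c \<le> d" "d \<le> t0" for c d
      unfolding H_def by (rule nn_integral_deriv_Icc) (use that \<rho> in \<open>auto intro: less_imp_le\<close>)
    have Zsq: "(?Z x)\<^sup>2 = exp (2 * ln (?Z x))" "ln ((?Z x)\<^sup>2) / 2 = ln (?Z x)" if "?Z x > 0" for x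
      using that by (simp_all add: exp_double ln_realpow)
    have upper: "ennreal ((B x * ?Z x) powr p * (exp (p * a * \<rho> (ln (?Z x))) * \<rho>' (ln (?Z x)) powr (1 - p)))
        \<le> ennreal ?A * (H t1 t2 (ln (?Z x)) * indicator {x. ?V x < r} x)" for x
    proof (cases "?Z x > 0 \<and> t1 \<le> ln (?Z x) \<and> ln (?Z x) \<le> t2 \<and> ?V x < r")
      case True
      define t where "t = ln (?Z x)"
      have t: "t1 \<le> t" "t \<le> t2" "t \<le> t0" "?Z x > 0" "?Z x = exp t" "(?Z x)\<^sup>2 < exp (2 * t0)" "ln ((?Z x)\<^sup>2) / 2 = t"
        using True t2 Zsq[of x] by (auto simp: t_def)
      have \<rho>t: "\<rho>' t > 0" using \<rho>(3) t by auto
      have g_eq: "g ((?Z x)\<^sup>2) = \<phi> t" "g' ((?Z x)\<^sup>2) = \<phi>' t / (2 * (?Z x)\<^sup>2)"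
        using t by (simp_all add: g_def g'_def)
      have "\<bar>plateau' y1 y2 L (\<rho> t) - a * plateau y1 y2 L (\<rho> t)\<bar>
          \<le> \<bar>plateau' y1 y2 L (\<rho> t)\<bar> + \<bar>a\<bar> * plateau y1 y2 L (\<rho> t)"
        using abs_triangle_ineq4[of "plateau' y1 y2 L (\<rho> t)" "a * plateau y1 y2 L (\<rho> t)"]
        by (simp add: abs_mult plateau_nonneg)
      also have "\<dots> \<le> \<eta> + \<bar>a\<bar> * 1"
        using abs_plateau'_le[OF L(1)] L(2) by (intro add_mono mult_left_mono plateau_le_1) auto
      finally have "\<bar>\<phi>' t\<bar> \<le> exp (- a * \<rho> t) * \<rho>' t * (\<eta> + \<bar>a\<bar>)"
        using \<rho>t by (simp add: \<phi>'_def abs_mult)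
      \<comment> \<open>The factors 2|z| from the squared norm, 1/(2|z|^2) from \<open>g'\<close>,
        and the outer |z| multiply to 1, leaving the derivative of \<open>\<phi>\<close> in ln
        |z|.\<close>
      then have 1: "2 * ?Z x * \<bar>g' ((?Z x)\<^sup>2) * h ((?V x)\<^sup>2)\<bar> * ?Z x \<le> exp (- a * \<rho> t) * \<rho>' t * (\<eta> + \<bar>a\<bar>)"
      proof -
        have "2 * ?Z x * \<bar>g' ((?Z x)\<^sup>2) * h ((?V x)\<^sup>2)\<bar> * ?Z x = \<bar>\<phi>' t\<bar> * h ((?V x)\<^sup>2)"
          unfolding g_eq abs_mult abs_of_nonneg[OF h_bounds(1)] using t(4)
          by (simp add: power2_eq_square field_simps)
        also have "\<dots> \<le> \<bar>\<phi>' t\<bar> * 1" by (intro mult_left_mono h_bounds) auto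
        finally show ?thesis using \<open>\<bar>\<phi>' t\<bar> \<le> _\<close> by simp
      qed
      \<comment> \<open>The remaining coordinates do not absorb the outer factor |z| = exp t.
        Compared with \<rho>' it is small, by the choice of \<open>T\<close>.\<close>
      have 2: "K * (2 * ?V x) * \<bar>g ((?Z x)\<^sup>2) * h' ((?V x)\<^sup>2)\<bar> * ?Z x \<le> exp (- a * \<rho> t) * \<rho>' t * \<eta>"
      proof -
        have "K * (2 * ?V x) * \<bar>g ((?Z x)\<^sup>2) * h' ((?V x)\<^sup>2)\<bar> * ?Z x
            = (K * (2 * ?V x) * \<bar>h' ((?V x)\<^sup>2)\<bar>) * \<bar>\<phi> t\<bar> * exp t"
          unfolding g_eq abs_mult by (simp add: t(5))
        also have "\<dots> \<le> K' * exp (- a * \<rho> t) * exp t"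
        proof (intro mult_right_mono mult_mono)
          show "K * (2 * ?V x) * \<bar>h' ((?V x)\<^sup>2)\<bar> \<le> K'"
            unfolding K'_def using True K r by (intro mult_mono h'_bound) auto
          show "\<bar>\<phi> t\<bar> \<le> exp (- a * \<rho> t)"
            using plateau_nonneg plateau_le_1 by (simp add: \<phi>_def abs_mult mult_left_le)
        qed (use K' in auto)
        also have "\<dots> = exp (- a * \<rho> t) * \<rho>' t * (K' * (exp t / \<rho>' t))" using \<rho>t by simp
        also have "\<dots> \<le> exp (- a * \<rho> t) * \<rho>' t * \<eta>"
          using T[of t] t t2 \<rho>t by (intro mult_left_mono) auto
        finally show ?thesis .
      qed
      have "B x * ?Z x \<le> (2 * ?Z x * \<bar>g' ((?Z x)\<^sup>2) * h ((?V x)\<^sup>2)\<bar>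
              + K * (2 * ?V x) * \<bar>g ((?Z x)\<^sup>2) * h' ((?V x)\<^sup>2)\<bar>) * ?Z x"
        using B[rule_format, of x] by (intro mult_right_mono) auto
      also have "\<dots> \<le> exp (- a * \<rho> t) * \<rho>' t * (\<bar>a\<bar> + 2 * \<eta>)"
        using 1 2 by (simp add: algebra_simps)
      finally have "(B x * ?Z x) powr p \<le> (exp (- a * \<rho> t) * \<rho>' t * (\<bar>a\<bar> + 2 * \<eta>)) powr p"
        using B[rule_format, of x] p by (intro powr_mono2) auto
      also have "\<dots> = exp (- (p * a * \<rho> t)) * \<rho>' t powr p * ?A"
        using \<rho>t \<eta> by (simp add: powr_mult exp_powr_real mult_ac)
      finally have "(B x * ?Z x) powr p * (exp (p * a * \<rho> t) * \<rho>' t powr (1 - p))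
          \<le> exp (- (p * a * \<rho> t)) * \<rho>' t powr p * ?A * (exp (p * a * \<rho> t) * \<rho>' t powr (1 - p))"
        by (intro mult_right_mono) auto
      also have "\<dots> = ?A * \<rho>' t"
        using \<rho>t by (simp add: exp_minus powr_diff)
      finally show ?thesis
        using True \<rho>t by (simp add: H_def t_def flip: ennreal_mult)
    next
      case False
      \<comment> \<open>Either |z| = 0, or \<open>g\<close> and \<open>g'\<close> both vanish, or
        \<open>h\<close> and \<open>h'\<close> both vanish; in the last two cases the upper bound
        for \<open>B\<close> is zero.\<close>
      have "B x * ?Z x = 0"
      proof (cases "?Z x > 0 \<and> ?V x < r")
        case True
        then have "ln (?Z x) < t1 \<or> t2 < ln (?Z x)" using False by auto
        then have "g ((?Z x)\<^sup>2) = 0 \<and> g' ((?Z x)\<^sup>2) = 0"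
          using True by (intro g_0) (simp add: Zsq)
        then show ?thesis using B[rule_format, of x] by simp
      next
        case False
        then consider "?Z x = 0" | "?V x \<ge> r" by fastforce
        then show ?thesis
        proof cases
          case 2
          then have "(?V x)\<^sup>2 \<ge> r\<^sup>2" using r by (intro power_mono) auto
          then show ?thesis using h_0[of "(?V x)\<^sup>2"] B[rule_format, of x] by simp
        qed simp
      qed
      then show ?thesis by (simp only: powr_0 mult_zero_left ennreal_0 zero_le)
    qed
    \<comment> \<open>On the plateau and in the inner cylinder the function is exactly exp(-a
      \<rho>), so its p-th power cancels the weight and precisely \<rho>' remains.\<close>
    have lower: "H s1 s2 (ln (?Z x)) * indicator {x. ?V x < r1} x * ?w x
        \<le> ennreal (\<bar>g ((?Z x)\<^sup>2) * h ((?V x)\<^sup>2)\<bar> powr p * (exp (p * a * \<rho> (ln (?Z x))) * \<rho>' (ln (?Z x)))) * ?w x" for x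
    proof (cases "?Z x > 0 \<and> s1 \<le> ln (?Z x) \<and> ln (?Z x) \<le> s2 \<and> ?V x < r1")
      case True
      define t where "t = ln (?Z x)"
      have t: "s1 \<le> t" "t \<le> s2" "t \<le> t0" "(?Z x)\<^sup>2 < exp (2 * t0)" "ln ((?Z x)\<^sup>2) / 2 = t"
        using True t2 ord Zsq[of x] by (auto simp: t_def)
      have "(?V x)\<^sup>2 \<le> r1\<^sup>2" using True by (intro power_mono) auto
      then have "h ((?V x)\<^sup>2) = 1" by (rule h_1)
      moreover have "y1 + L \<le> \<rho> t" "\<rho> t \<le> y2 - L"
        using \<rho>_le_iff[of s1 t] \<rho>_le_iff[of t s2] t s1 s2 by auto
      then have "g ((?Z x)\<^sup>2) = exp (- a * \<rho> t)"
        using t True plateau_eq_1[OF L(1)] by (simp add: g_def \<phi>_def)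
      ultimately have "\<bar>g ((?Z x)\<^sup>2) * h ((?V x)\<^sup>2)\<bar> powr p = exp (- (p * a * \<rho> t))"
        by (simp add: exp_powr_real mult_ac)
      then have "\<bar>g ((?Z x)\<^sup>2) * h ((?V x)\<^sup>2)\<bar> powr p * (exp (p * a * \<rho> t) * \<rho>' t) = \<rho>' t"
        by (simp add: exp_minus)
      then have "\<bar>g ((?Z x)\<^sup>2) * h ((?V x)\<^sup>2)\<bar> powr p * (exp (p * a * \<rho> (ln (?Z x))) * \<rho>' (ln (?Z x)))
          = \<rho>' (ln (?Z x))"
        by (simp only: t_def)
      then show ?thesis
        by (intro mult_right_mono) (simp_all only: H_def indicator_def, auto)
    next
      case False
      then show ?thesis by (cases "?Z x > 0") (auto simp: H_def indicator_def)
    qed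
    define v where "v = enn2real (shell_vol S r1)"
    have v: "shell_vol S r1 = ennreal v" "v > 0"
      using shell_vol_finite[OF S(1), of r1] shell_vol_pos[OF S r(3)]
      by (auto simp: v_def ennreal_enn2real enn2real_positive_iff)
    have v_r: "shell_vol S r = ennreal (l ^ card (Basis - S) * v)"
      using shell_vol_scale[OF S(1), of l r1] l r v by (simp add: ennreal_mult)
    have "(\<integral>\<^sup>+x. ennreal ((B x * ?Z x) powr p * (exp (p * a * \<rho> (ln (?Z x))) * \<rho>' (ln (?Z x)) powr (1 - p))) * ?w x \<partial>lborel)
        \<le> (\<integral>\<^sup>+x. ennreal ?A * (H t1 t2 (ln (?Z x)) * indicator {x. ?V x < r} x * ?w x) \<partial>lborel)"
      by (intro nn_integral_mono) (use upper in \<open>simp add: mult.assoc[symmetric] mult_right_mono\<close>)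
    also have "\<dots> = ennreal ?A * (shell_vol S r * (\<integral>\<^sup>+t. H t1 t2 t \<partial>lborel))"
      by (subst nn_integral_cmult) (simp_all add: nn_integral_radial[OF S(1)])
    also have "\<dots> = ennreal (?A * (l ^ card (Basis - S) * v * (l0 + 2 * L)))"
      using H_int[of t1 t2] ord t1 t2 v l l0 L by (simp add: v_r ennreal_mult y1_def flip: y2_def)
    \<comment> \<open>One factor 1 + \<eta> comes from the volume ratio, the other from
      \<open>l0 + 2 * L = (1 + \<eta>) * l0\<close>. The common factor \<open>v * l0\<close> is
      finite and positive, so the slack against \<open>C\<close> stays strict.\<close>
    also have "\<dots> \<le> ennreal ((\<bar>a\<bar> + 2 * \<eta>) powr p * (1 + \<eta>)\<^sup>2 * (v * l0))"
    proof (intro ennreal_leI)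
      have "?A * (l ^ card (Basis - S) * v * (l0 + 2 * L)) \<le> ?A * ((1 + \<eta>) * v * (l0 + 2 * L))"
        using l v l0 L by (intro mult_left_mono mult_right_mono) auto
      then show "?A * (l ^ card (Basis - S) * v * (l0 + 2 * L)) \<le> ?A * (1 + \<eta>)\<^sup>2 * (v * l0)"
        unfolding l0(2) by (simp add: power2_eq_square mult_ac)
    qed
    also have "\<dots> < ennreal (C * (v * l0))"
      using \<eta> v l0 by (intro ennreal_lessI mult_strict_right_mono mult_pos_pos) (auto intro: le_less_trans[rotated])
    also have "\<dots> = ennreal C * (shell_vol S r1 * (\<integral>\<^sup>+t. H s1 s2 t \<partial>lborel))"
    proof -
      have "C \<ge> 0" using C by (meson less_imp_le order_trans powr_ge_zero)
      moreover have "\<rho> s2 - \<rho> s1 = l0" using s1 s2 by (simp add: y1_def)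
      ultimately show ?thesis using H_int[of s1 s2] ord s2 v l0 by (simp add: ennreal_mult)
    qed
    also have "\<dots> = ennreal C * (\<integral>\<^sup>+x. H s1 s2 (ln (?Z x)) * indicator {x. ?V x < r1} x * ?w x \<partial>lborel)"
      by (simp add: nn_integral_radial[OF S(1)])
    also have "\<dots> \<le> ennreal C * (\<integral>\<^sup>+x. ennreal (\<bar>g ((?Z x)\<^sup>2) * h ((?V x)\<^sup>2)\<bar> powr p
        * (exp (p * a * \<rho> (ln (?Z x))) * \<rho>' (ln (?Z x)))) * ?w x \<partial>lborel)"
      by (intro mult_left_mono nn_integral_mono lower) auto
    finally have "(\<integral>\<^sup>+x. ennreal ((B x * ?Z x) powr p * (exp (p * a * \<rho> (ln (?Z x))) * \<rho>' (ln (?Z x)) powr (1 - p))) * ?w x \<partial>lborel)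
      < ennreal C * (\<integral>\<^sup>+x. ennreal (\<bar>g ((?Z x)\<^sup>2) * h ((?V x)\<^sup>2)\<bar> powr p
        * (exp (p * a * \<rho> (ln (?Z x))) * \<rho>' (ln (?Z x)))) * ?w x \<partial>lborel)" .
    }
    then show "\<forall>B. (\<forall>x. 0 \<le> B x \<and> B x \<le> 2 * ?Z x * \<bar>g' ((?Z x)\<^sup>2) * h ((?V x)\<^sup>2)\<bar>
              + K * (2 * ?V x) * \<bar>g ((?Z x)\<^sup>2) * h' ((?V x)\<^sup>2)\<bar>) \<longrightarrow>
      (\<integral>\<^sup>+x. ennreal ((B x * ?Z x) powr p * (exp (p * a * \<rho> (ln (?Z x))) * \<rho>' (ln (?Z x)) powr (1 - p)))
        * ennreal (?Z x powr - real (card S)) \<partial>lborel)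
      < ennreal C * (\<integral>\<^sup>+x. ennreal (\<bar>g ((?Z x)\<^sup>2) * h ((?V x)\<^sup>2)\<bar> powr p
        * (exp (p * a * \<rho> (ln (?Z x))) * \<rho>' (ln (?Z x)))) * ennreal (?Z x powr - real (card S)) \<partial>lborel)"
      by blast
  qed
qed

subsection \<open>Coordinates in the product space\<close>

lemma inner_proj_right:
  assumes "S \<subseteq> Basis"
  shows "proj S x \<bullet> proj S y = proj S x \<bullet> y"
proof -
  have "proj S x \<bullet> (y - proj S y) = (\<Sum>b\<in>Basis. (proj S x \<bullet> b) * ((y - proj S y) \<bullet> b))"
    by (rule euclidean_inner)
  also have "\<dots> = 0"
    by (rule sum.neutral) (use assms in \<open>auto simp: inner_proj_Basis inner_diff_left\<close>)
  finally show ?thesis by (simp add: inner_diff_right)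
qed

lemma has_derivative_norm_proj_square:
  assumes "S \<subseteq> Basis"
  shows "((\<lambda>x. (norm (proj S x))\<^sup>2) has_derivative (\<lambda>v. 2 * (proj S x \<bullet> v))) (at x)"
proof -
  have d: "(proj S has_derivative proj S) (at x)"
    by (rule bounded_linear_imp_has_derivative[OF bounded_linear_proj])
  have "proj S x \<bullet> proj S v + proj S v \<bullet> proj S x = 2 * (proj S x \<bullet> v)" for v
    using inner_proj_right[OF assms, of x v] inner_commute[of "proj S v" "proj S x"] by linarith
  then show ?thesis
    unfolding power2_norm_eq_inner
    by (intro has_derivative_eq_rhs[OF has_derivative_inner[OF d d]] ext)
qed

text \<open>Written as a bounded linear map because \<open>C1_0\<close> asks for continuity of the
  derivative in operator norm; with squared norms as arguments this reduces to continuity of scalar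
  coefficients.\<close>

definition cutoff_deriv ::
  "'a::euclidean_space set \<Rightarrow> (real \<Rightarrow> real) \<Rightarrow> (real \<Rightarrow> real) \<Rightarrow> (real \<Rightarrow> real) \<Rightarrow> (real \<Rightarrow> real) \<Rightarrow> 'a \<Rightarrow> 'a \<Rightarrow>\<^sub>L real"
  where "cutoff_deriv S g g' h h' x =
    (2 * (g' ((norm (proj S x))\<^sup>2) * h ((norm (proj (Basis - S) x))\<^sup>2))) *\<^sub>R blinfun_inner_right (proj S x) +
    (2 * (g ((norm (proj S x))\<^sup>2) * h' ((norm (proj (Basis - S) x))\<^sup>2))) *\<^sub>R blinfun_inner_right (proj (Basis - S) x)"

lemma has_derivative_cutoff:
  fixes S :: "'a::euclidean_space set"
  assumes S: "S \<subseteq> Basis"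
    and g: "\<And>y. (g has_real_derivative g' y) (at y)" and h: "\<And>y. (h has_real_derivative h' y) (at y)"
  shows "((\<lambda>x. g ((norm (proj S x))\<^sup>2) * h ((norm (proj (Basis - S) x))\<^sup>2))
           has_derivative blinfun_apply (cutoff_deriv S g g' h h' x)) (at x)"
proof -
  have 1: "((\<lambda>x. g ((norm (proj S x))\<^sup>2)) has_derivative
      (\<lambda>v. g' ((norm (proj S x))\<^sup>2) * (2 * (proj S x \<bullet> v)))) (at x)"
    using has_derivative_compose[OF has_derivative_norm_proj_square[OF S] g[unfolded has_field_derivative_def]] .
  have 2: "((\<lambda>x. h ((norm (proj (Basis - S) x))\<^sup>2)) has_derivative
      (\<lambda>v. h' ((norm (proj (Basis - S) x))\<^sup>2) * (2 * (proj (Basis - S) x \<bullet> v)))) (at x)"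
    using has_derivative_compose[OF has_derivative_norm_proj_square[of "Basis - S"] h[unfolded has_field_derivative_def]]
    by auto
  show ?thesis
    by (rule has_derivative_eq_rhs[OF has_derivative_mult[OF 1 2]])
      (simp add: cutoff_deriv_def fun_eq_iff blinfun.add_left blinfun.scaleR_left algebra_simps)
qed

lemma continuous_on_cutoff_deriv:
  fixes S :: "'a::euclidean_space set"
  assumes g: "\<And>y. (g has_real_derivative g' y) (at y)" "continuous_on UNIV g'"
    and h: "\<And>y. (h has_real_derivative h' y) (at y)" "continuous_on UNIV h'"
  shows "continuous_on UNIV (cutoff_deriv S g g' h h')"
proof -
  have cg: "continuous_on UNIV g" and ch: "continuous_on UNIV h"
    using g(1) h(1) by (meson continuous_at_imp_continuous_on DERIV_isCont)+
  have c: "continuous_on UNIV (\<lambda>x. f ((norm (proj T x))\<^sup>2))"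
    if "continuous_on UNIV f" for f :: "real \<Rightarrow> real" and T :: "'a set"
    by (rule continuous_on_compose2[OF that]) (auto intro!: continuous_intros)
  show ?thesis
    unfolding cutoff_deriv_def[abs_def]
    by (intro continuous_intros c cg ch g h
        bounded_linear.continuous_on[OF bounded_linear_blinfun_inner_right])
qed

text \<open>Realises the index set \<open>M\<close> as basis vectors of the product space, so that
  |z| is the norm of a \<open>proj\<close> and the dilations of z become instances of
  \<open>dil\<close>.\<close>

definition coord_basis :: "'n set \<Rightarrow> ((real^'n::finite) \<times> (real^'k::finite)) set" where
  "coord_basis M = (\<lambda>i. (axis i 1, 0)) ` M"

lemma coord_basis_subset: "coord_basis M \<subseteq> Basis"
  by (auto simp: coord_basis_def Basis_prod_def Basis_vec_def)

lemma inj_coord_basis: "inj_on (\<lambda>i::'n::finite. (axis i (1::real), 0 :: real^'k::finite)) M"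
  by (auto simp: inj_on_def axis_eq_axis)

lemma card_coord_basis: "card (coord_basis M :: ((real^'n::finite) \<times> (real^'k::finite)) set) = card M"
  unfolding coord_basis_def by (rule card_image[OF inj_coord_basis])

lemma norm_proj_coord_basis:
  "norm (proj (coord_basis M) \<xi>) = znorm M \<xi>"
  unfolding norm_proj[OF coord_basis_subset] znorm_def
  unfolding coord_basis_def sum.reindex[OF inj_coord_basis]
  by (simp add: inner_prod_def inner_axis)

lemma norm_fst_square: "(norm (fst \<xi>))\<^sup>2 = (znorm M \<xi>)\<^sup>2 + (\<Sum>i\<in>-M. (fst \<xi> $ i)\<^sup>2)"
  for M :: "'n::finite set" and \<xi> :: "(real^'n) \<times> (real^'k::finite)"
proof -
  have "(norm (fst \<xi>))\<^sup>2 = (\<Sum>i\<in>UNIV. (fst \<xi> $ i)\<^sup>2)"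
    by (simp add: norm_vec_def L2_set_def sum_nonneg)
  also have "\<dots> = (\<Sum>i\<in>-M. (fst \<xi> $ i)\<^sup>2) + (\<Sum>i\<in>M. (fst \<xi> $ i)\<^sup>2)"
    using sum.subset_diff[of M UNIV] by (simp add: Compl_eq_Diff_UNIV)
  finally show ?thesis by (simp add: znorm_def sum_nonneg)
qed

text \<open>Two applications of Pythagoras, in the whole space and in x, avoid enumerating the
  complementary basis vectors.\<close>

lemma norm_proj_compl_coord_basis:
  "norm (proj (Basis - coord_basis M) \<xi>) = restnorm M \<xi>"
proof -
  have "(norm \<xi>)\<^sup>2 = (norm (fst \<xi>))\<^sup>2 + (norm (snd \<xi>))\<^sup>2"
    by (simp add: norm_prod_def)
  then have "(norm (proj (Basis - coord_basis M) \<xi>))\<^sup>2 = (\<Sum>i\<in>-M. (fst \<xi> $ i)\<^sup>2) + (norm (snd \<xi>))\<^sup>2"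
    using norm_proj_Pythagoras[OF coord_basis_subset, of \<xi> M]
    by (simp add: norm_fst_square[of \<xi> M] norm_proj_coord_basis)
  then show ?thesis
    unfolding restnorm_def by (metis norm_ge_zero real_sqrt_unique)
qed

lemma znorm_le_norm_fst: "znorm M \<xi> \<le> norm (fst \<xi>)"
  by (rule power2_le_imp_le) (auto simp: norm_fst_square[of \<xi> M] sum_nonneg)

lemma znorm_nonneg [simp]: "znorm M \<xi> \<ge> 0"
  by (simp add: znorm_def sum_nonneg)

lemma restnorm_nonneg [simp]: "restnorm M \<xi> \<ge> 0"
  by (simp add: restnorm_def sum_nonneg)

lemma continuous_on_znorm: "continuous_on UNIV (znorm M)"
  unfolding norm_proj_coord_basis[symmetric, abs_def] by (intro continuous_intros)

lemma continuous_on_restnorm: "continuous_on UNIV (restnorm M)"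
  unfolding norm_proj_compl_coord_basis[symmetric, abs_def] by (intro continuous_intros)

lemma norm_fst_le: "norm (fst \<xi>) \<le> znorm M \<xi> + restnorm M \<xi>"
proof (rule power2_le_imp_le)
  have "(norm (fst \<xi>))\<^sup>2 \<le> (znorm M \<xi>)\<^sup>2 + (restnorm M \<xi>)\<^sup>2"
    by (simp add: norm_fst_square[of \<xi> M] restnorm_def sum_nonneg)
  also have "\<dots> \<le> (znorm M \<xi> + restnorm M \<xi>)\<^sup>2"
    by (simp add: power2_sum)
  finally show "(norm (fst \<xi>))\<^sup>2 \<le> (znorm M \<xi> + restnorm M \<xi>)\<^sup>2" .
qed simp

section \<open>The gradient with the degenerate weight\<close>

lemma grad_eq:
  assumes "(u has_derivative blinfun_apply D) (at \<xi>)"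
  shows "grad_x u \<xi> $ i = D (axis i 1, 0)" "grad_y u \<xi> $ j = D (0, axis j 1)"
  by (simp_all add: grad_x_def grad_y_def frechet_derivative_at[OF assms, symmetric])

lemma grad_gamma_norm_nonneg [simp]: "grad_gamma_norm \<gamma> u \<xi> \<ge> 0"
  by (simp add: grad_gamma_norm_def)

text \<open>Cauchy-Schwarz over the indices in \<open>M\<close>. These are x-directions, where the
  gradient has weight 1, so the bound has no factor depending on \<gamma>; all other components are
  discarded.\<close>

lemma deriv_dilation_le:
  fixes u :: "(real^'n::finite) \<times> (real^'k::finite) \<Rightarrow> real"
  assumes "(u has_derivative blinfun_apply D) (at \<xi>)"
  shows "\<bar>D (proj (coord_basis M) \<xi>)\<bar> \<le> znorm M \<xi> * grad_gamma_norm \<gamma> u \<xi>"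
proof -
  have "D (proj (coord_basis M) \<xi>) = (\<Sum>i\<in>M. fst \<xi> $ i * grad_x u \<xi> $ i)"
    unfolding proj_def coord_basis_def sum.reindex[OF inj_coord_basis]
    by (simp add: blinfun.sum_right blinfun.scaleR_right grad_eq[OF assms] inner_prod_def inner_axis
        del: scaleR_Pair)
  also have "\<bar>\<dots>\<bar> \<le> (\<Sum>i\<in>M. \<bar>fst \<xi> $ i\<bar> * \<bar>grad_x u \<xi> $ i\<bar>)"
    by (rule order_trans[OF sum_abs]) (simp add: abs_mult)
  also have "\<dots> \<le> L2_set (\<lambda>i. fst \<xi> $ i) M * L2_set (\<lambda>i. grad_x u \<xi> $ i) M"
    by (rule L2_set_mult_ineq)
  also have "\<dots> \<le> znorm M \<xi> * grad_gamma_norm \<gamma> u \<xi>"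
  proof (rule mult_mono)
    show "L2_set (\<lambda>i. fst \<xi> $ i) M \<le> znorm M \<xi>" by (simp add: L2_set_def znorm_def)
    have "L2_set (\<lambda>i. grad_x u \<xi> $ i) M \<le> norm (grad_x u \<xi>)"
      unfolding L2_set_def norm_vec_def by (auto intro!: sum_mono2)
    also have "\<dots> \<le> grad_gamma_norm \<gamma> u \<xi>"
      unfolding grad_gamma_norm_def by (rule real_le_rsqrt) simp
    finally show "L2_set (\<lambda>i. grad_x u \<xi> $ i) M \<le> grad_gamma_norm \<gamma> u \<xi>" .
  qed auto
  finally show ?thesis .
qed

text \<open>The gradient splits orthogonally into a z-part and the rest. In the rest, x-components
  have weight 1 and y-components have weight \<open>xweight\<close>; \<open>K \<ge> 1\<close>
  dominates both. The bound on \<open>xweight\<close> is requested only where \<open>g * h'\<close>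
  is nonzero, since for \<gamma> > 0 the weight is unbounded globally.\<close>

lemma grad_gamma_norm_cutoff_le:
  fixes M :: "'n::finite set" and \<xi> :: "(real^'n) \<times> (real^'k::finite)"
  assumes g: "\<And>y. (g has_real_derivative g' y) (at y)" and h: "\<And>y. (h has_real_derivative h' y) (at y)"
    and K: "K \<ge> 1" "g ((znorm M \<xi>)\<^sup>2) * h' ((restnorm M \<xi>)\<^sup>2) \<noteq> 0 \<Longrightarrow> xweight \<gamma> \<xi> \<le> K"
  shows "grad_gamma_norm \<gamma> (\<lambda>\<xi>. g ((znorm M \<xi>)\<^sup>2) * h ((restnorm M \<xi>)\<^sup>2)) \<xi>
     \<le> 2 * znorm M \<xi> * \<bar>g' ((znorm M \<xi>)\<^sup>2) * h ((restnorm M \<xi>)\<^sup>2)\<bar>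
       + K * (2 * restnorm M \<xi>) * \<bar>g ((znorm M \<xi>)\<^sup>2) * h' ((restnorm M \<xi>)\<^sup>2)\<bar>"
proof -
  let ?S = "coord_basis M :: ((real^'n) \<times> (real^'k)) set"
  define u where "u \<xi> = g ((znorm M \<xi>)\<^sup>2) * h ((restnorm M \<xi>)\<^sup>2)" for \<xi> :: "(real^'n) \<times> (real^'k)"
  define A where "A = g' ((znorm M \<xi>)\<^sup>2) * h ((restnorm M \<xi>)\<^sup>2)"
  define B where "B = g ((znorm M \<xi>)\<^sup>2) * h' ((restnorm M \<xi>)\<^sup>2)"
  let ?D = "cutoff_deriv ?S g g' h h' \<xi>"
  have D: "(u has_derivative blinfun_apply ?D) (at \<xi>)"
    using has_derivative_cutoff[where S="?S" and x=\<xi>, OF coord_basis_subset g h]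
    by (simp add: u_def[abs_def] norm_proj_coord_basis norm_proj_compl_coord_basis)
  have D_apply: "?D v = 2 * A * (proj ?S \<xi> \<bullet> v) + 2 * B * (proj (Basis - ?S) \<xi> \<bullet> v)" for v
    by (simp add: cutoff_deriv_def A_def B_def norm_proj_coord_basis norm_proj_compl_coord_basis
        blinfun.add_left blinfun.scaleR_left)
  have mem: "(axis i 1, 0) \<in> ?S \<longleftrightarrow> i \<in> M" "(axis i 1, 0) \<in> (Basis :: ((real^'n) \<times> (real^'k)) set)"
      "(0, axis j 1) \<notin> ?S" "(0, axis j 1) \<in> (Basis :: ((real^'n) \<times> (real^'k)) set)" for i j
    by (auto simp: coord_basis_def Basis_prod_def Basis_vec_def axis_eq_axis zero_prod_def[symmetric])
  have gx: "grad_x u \<xi> $ i = 2 * (if i \<in> M then A else B) * fst \<xi> $ i" for i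
    unfolding grad_eq[OF D] D_apply
    by (simp add: inner_proj_Basis coord_basis_subset mem inner_prod_def[of \<xi>] inner_axis)
  have gy: "grad_y u \<xi> $ j = 2 * B * snd \<xi> $ j" for j
    unfolding grad_eq[OF D] D_apply
    by (simp add: inner_proj_Basis coord_basis_subset mem inner_prod_def[of \<xi>] inner_axis)
  have nx: "(norm (grad_x u \<xi>))\<^sup>2 = (2 * A * znorm M \<xi>)\<^sup>2 + (2 * B)\<^sup>2 * (\<Sum>i\<in>-M. (fst \<xi> $ i)\<^sup>2)"
  proof -
    have "(norm (grad_x u \<xi>))\<^sup>2 = (\<Sum>i\<in>UNIV. (grad_x u \<xi> $ i)\<^sup>2)"
      by (simp add: norm_vec_def L2_set_def sum_nonneg)
    also have "\<dots> = (\<Sum>i\<in>-M. (grad_x u \<xi> $ i)\<^sup>2) + (\<Sum>i\<in>M. (grad_x u \<xi> $ i)\<^sup>2)"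
      using sum.subset_diff[of M UNIV] by (simp add: Compl_eq_Diff_UNIV)
    also have "(\<Sum>i\<in>M. (grad_x u \<xi> $ i)\<^sup>2) = (2 * A * znorm M \<xi>)\<^sup>2"
      by (simp add: gx znorm_def power_mult_distrib sum_nonneg flip: sum_distrib_left)
    also have "(\<Sum>i\<in>-M. (grad_x u \<xi> $ i)\<^sup>2) = (2 * B)\<^sup>2 * (\<Sum>i\<in>-M. (fst \<xi> $ i)\<^sup>2)"
      by (simp add: gx power_mult_distrib flip: sum_distrib_left)
    finally show ?thesis by simp
  qed
  have ny: "norm (grad_y u \<xi>) = 2 * \<bar>B\<bar> * norm (snd \<xi>)"
  proof -
    have "grad_y u \<xi> = (2 * B) *\<^sub>R snd \<xi>" by (simp add: vec_eq_iff gy)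
    then show ?thesis by (simp add: abs_mult)
  qed
  have w: "(xweight \<gamma> \<xi> * norm (grad_y u \<xi>))\<^sup>2 \<le> (K * (2 * \<bar>B\<bar> * norm (snd \<xi>)))\<^sup>2"
  proof (cases "B = 0")
    case False
    then have "xweight \<gamma> \<xi> \<le> K" using K(2) by (simp add: B_def)
    moreover have "xweight \<gamma> \<xi> \<ge> 0" by (simp add: xweight_def)
    ultimately show ?thesis unfolding ny by (intro power_mono mult_right_mono) auto
  qed (simp add: ny)
  have "(2 * B)\<^sup>2 * (\<Sum>i\<in>-M. (fst \<xi> $ i)\<^sup>2) \<le> K\<^sup>2 * ((2 * B)\<^sup>2 * (\<Sum>i\<in>-M. (fst \<xi> $ i)\<^sup>2))"
    using mult_right_mono[OF one_le_power[OF K(1)], of "(2 * B)\<^sup>2 * (\<Sum>i\<in>-M. (fst \<xi> $ i)\<^sup>2)" 2]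
    by (simp add: sum_nonneg)
  then have "(norm (grad_x u \<xi>))\<^sup>2 + (xweight \<gamma> \<xi> * norm (grad_y u \<xi>))\<^sup>2
      \<le> (2 * A * znorm M \<xi>)\<^sup>2 + K\<^sup>2 * (2 * B)\<^sup>2 * ((\<Sum>i\<in>-M. (fst \<xi> $ i)\<^sup>2) + (norm (snd \<xi>))\<^sup>2)"
    using w unfolding nx by (simp add: power_mult_distrib algebra_simps)
  also have "\<dots> = (2 * znorm M \<xi> * \<bar>A\<bar>)\<^sup>2 + (K * (2 * restnorm M \<xi>) * \<bar>B\<bar>)\<^sup>2"
    by (simp add: restnorm_def power_mult_distrib sum_nonneg)
  also have "\<dots> \<le> (2 * znorm M \<xi> * \<bar>A\<bar> + K * (2 * restnorm M \<xi>) * \<bar>B\<bar>)\<^sup>2"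
    using K(1) by (simp add: power2_sum)
  finally have "grad_gamma_norm \<gamma> u \<xi> \<le> 2 * znorm M \<xi> * \<bar>A\<bar> + K * (2 * restnorm M \<xi>) * \<bar>B\<bar>"
    unfolding grad_gamma_norm_def using K(1) by (intro real_le_lsqrt) auto
  then show ?thesis unfolding A_def B_def u_def .
qed

text \<open>In both parts the weights are \<open>exp (p * a * \<rho>) * \<rho>'\<close> and \<open>exp (p * a * \<rho>) * \<rho>' powr (1 - p)\<close>
  in the variable \<open>ln |z|\<close>, against the dilation-invariant measure \<open>|z|\<^sup>-\<^sup>m d\<xi>\<close>.\<close>

lemma hardy_grushin:
  fixes u :: "(real^'n::finite) \<times> (real^'k::finite) \<Rightarrow> real" and M :: "'n set"
    and wL wR :: "(real^'n) \<times> (real^'k) \<Rightarrow> real"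
  assumes p: "p > 1" and u: "C1_0 \<Omega> u"
    and \<rho>: "\<And>t. t \<le> d \<Longrightarrow> (\<rho> has_real_derivative \<rho>' t) (at t)" "continuous_on {..d} \<rho>'"
           "\<And>t. t \<le> d \<Longrightarrow> \<rho>' t > 0"
    and meas [measurable]: "\<rho> \<in> borel_measurable borel" "\<rho>' \<in> borel_measurable borel"
    and supp: "\<And>\<xi>. u \<xi> \<noteq> 0 \<Longrightarrow> znorm M \<xi> < exp d"
              "a < 0 \<Longrightarrow> \<exists>c. \<forall>\<xi>. u \<xi> \<noteq> 0 \<longrightarrow> exp c < znorm M \<xi>"
    and w0: "\<And>\<xi>. znorm M \<xi> = 0 \<Longrightarrow> wL \<xi> = 0"
    and wL: "\<And>\<xi>. 0 < znorm M \<xi> \<Longrightarrow> znorm M \<xi> \<le> exp d \<Longrightarrow>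
        wL \<xi> = exp (p * a * \<rho> (ln (znorm M \<xi>))) * \<rho>' (ln (znorm M \<xi>)) * znorm M \<xi> powr - real (card M)"
    and wR: "\<And>\<xi>. 0 < znorm M \<xi> \<Longrightarrow> znorm M \<xi> \<le> exp d \<Longrightarrow>
        wR \<xi> = znorm M \<xi> powr p * (exp (p * a * \<rho> (ln (znorm M \<xi>))) * \<rho>' (ln (znorm M \<xi>)) powr (1 - p))
          * znorm M \<xi> powr - real (card M)"
  shows "ennreal (\<bar>a\<bar> powr p) * (\<integral>\<^sup>+\<xi>\<in>\<Omega>. ennreal (\<bar>u \<xi>\<bar> powr p * wL \<xi>) \<partial>lborel)
      \<le> (\<integral>\<^sup>+\<xi>\<in>\<Omega>. ennreal (grad_gamma_norm \<gamma> u \<xi> powr p * wR \<xi>) \<partial>lborel)"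
proof -
  let ?S = "coord_basis M :: ((real^'n) \<times> (real^'k)) set"
  obtain D where D: "continuous_on UNIV D" "\<And>\<xi>. (u has_derivative blinfun_apply (D \<xi>)) (at \<xi>)"
    and cl: "closure {\<xi>. u \<xi> \<noteq> 0} \<subseteq> \<Omega>"
    using u by (auto simp: C1_0_def)
  \<comment> \<open>The complement of the closed support is open and \<open>u\<close> is zero on it,
    so the derivative vanishes off \<Omega>. Integrals over the whole space can thus be bounded by
    integrals over \<Omega>.\<close>
  have D0: "D \<xi> v = 0" if "\<xi> \<notin> \<Omega>" for \<xi> v
  proof -
    have "\<xi> \<in> - closure {\<xi>. u \<xi> \<noteq> 0}" using cl that by blast
    then have "(u has_derivative (\<lambda>_. 0)) (at \<xi>)"
      using has_derivative_transform_within_open[OF has_derivative_const[of 0], of "- closure {\<xi>. u \<xi> \<noteq> 0}" \<xi> u]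
        closure_subset[of "{\<xi>. u \<xi> \<noteq> 0}"]
      by (metis (mono_tags, lifting) ComplD mem_Collect_eq open_Compl closed_closure subset_iff)
    then show ?thesis using has_derivative_unique[OF D(2)] by metis
  qed
  let ?ind = "\<lambda>\<xi>. indicator {\<xi>. 0 < znorm M \<xi> \<and> znorm M \<xi> \<le> exp d} \<xi> :: ennreal"
  define PL where "PL \<xi> = \<bar>a\<bar> powr p * (\<bar>u \<xi>\<bar> powr p *
            (exp (p * a * \<rho> (ln (znorm M \<xi>))) * \<rho>' (ln (znorm M \<xi>))))" for \<xi>
  define PR where "PR \<xi> = \<bar>D \<xi> (proj ?S \<xi>)\<bar> powr p *
            (exp (p * a * \<rho> (ln (znorm M \<xi>))) * \<rho>' (ln (znorm M \<xi>)) powr (1 - p))" for \<xi>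
  have main: "(\<integral>\<^sup>+\<xi>. ennreal (PL \<xi>) * ?ind \<xi> * ennreal (znorm M \<xi> powr - real (card M)) \<partial>lborel)
     \<le> (\<integral>\<^sup>+\<xi>. ennreal (PR \<xi>) * ?ind \<xi> * ennreal (znorm M \<xi> powr - real (card M)) \<partial>lborel)"
    using hardy_dilation[where S="?S" and a=a, OF coord_basis_subset p D(2,1) \<rho> meas] supp
    by (simp add: norm_proj_coord_basis card_coord_basis PL_def PR_def)
  have contu: "continuous_on UNIV u"
    using D(2) by (meson continuous_at_imp_continuous_on has_derivative_continuous)
  have [measurable]: "u \<in> borel_measurable borel"
    by (rule borel_measurable_continuous_onI[OF contu])
  have "ennreal (\<bar>a\<bar> powr p) * (\<integral>\<^sup>+\<xi>\<in>\<Omega>. ennreal (\<bar>u \<xi>\<bar> powr p * wL \<xi>) \<partial>lborel)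
      \<le> ennreal (\<bar>a\<bar> powr p) * (\<integral>\<^sup>+\<xi>. ennreal (\<bar>u \<xi>\<bar> powr p *
            (exp (p * a * \<rho> (ln (znorm M \<xi>))) * \<rho>' (ln (znorm M \<xi>)))) * ?ind \<xi> * ennreal (znorm M \<xi> powr - real (card M)) \<partial>lborel)"
  proof (intro mult_left_mono nn_integral_mono)
    fix \<xi>
    show "ennreal (\<bar>u \<xi>\<bar> powr p * wL \<xi>) * indicator \<Omega> \<xi> \<le> ennreal (\<bar>u \<xi>\<bar> powr p *
            (exp (p * a * \<rho> (ln (znorm M \<xi>))) * \<rho>' (ln (znorm M \<xi>)))) * ?ind \<xi> * ennreal (znorm M \<xi> powr - real (card M))"
    proof (cases "u \<xi> = 0 \<or> znorm M \<xi> = 0")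
      case True
      then show ?thesis using w0[of \<xi>] by auto
    next
      case False
      then have z: "0 < znorm M \<xi>" "znorm M \<xi> \<le> exp d"
        using supp(1)[of \<xi>] znorm_nonneg[of M \<xi>] by (auto simp: less_le)
      have "ln (znorm M \<xi>) \<le> d" using z ln_le_cancel_iff[of "znorm M \<xi>" "exp d"] by simp
      then have "\<rho>' (ln (znorm M \<xi>)) > 0" by (rule \<rho>(3))
      then have "ennreal (\<bar>u \<xi>\<bar> powr p * wL \<xi>) = ennreal (\<bar>u \<xi>\<bar> powr p *
            (exp (p * a * \<rho> (ln (znorm M \<xi>))) * \<rho>' (ln (znorm M \<xi>)))) * ?ind \<xi> * ennreal (znorm M \<xi> powr - real (card M))"
        using z by (simp add: wL mult.assoc flip: ennreal_mult)
      then show ?thesis by (simp add: indicator_def)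
    qed
  qed auto
  also have "\<dots> = (\<integral>\<^sup>+\<xi>. ennreal (\<bar>a\<bar> powr p) * (ennreal (\<bar>u \<xi>\<bar> powr p *
            (exp (p * a * \<rho> (ln (znorm M \<xi>))) * \<rho>' (ln (znorm M \<xi>)))) * ?ind \<xi> * ennreal (znorm M \<xi> powr - real (card M))) \<partial>lborel)"
    unfolding norm_proj_coord_basis[symmetric] by (rule nn_integral_cmult[symmetric]) measurable
  also have "\<dots> = (\<integral>\<^sup>+\<xi>. ennreal (PL \<xi>) * ?ind \<xi> * ennreal (znorm M \<xi> powr - real (card M)) \<partial>lborel)"
    unfolding PL_def by (intro nn_integral_cong) (simp add: ennreal_mult' mult.assoc)
  also note main
  also have "(\<integral>\<^sup>+\<xi>. ennreal (PR \<xi>) * ?ind \<xi> * ennreal (znorm M \<xi> powr - real (card M)) \<partial>lborel)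
      \<le> (\<integral>\<^sup>+\<xi>\<in>\<Omega>. ennreal (grad_gamma_norm \<gamma> u \<xi> powr p * wR \<xi>) \<partial>lborel)"
  proof (rule nn_integral_mono)
    fix \<xi>
    show "ennreal (PR \<xi>) * ?ind \<xi> * ennreal (znorm M \<xi> powr - real (card M))
        \<le> ennreal (grad_gamma_norm \<gamma> u \<xi> powr p * wR \<xi>) * indicator \<Omega> \<xi>"
    proof (cases "\<xi> \<in> \<Omega> \<and> 0 < znorm M \<xi> \<and> znorm M \<xi> \<le> exp d")
      case True
      have "\<bar>D \<xi> (proj ?S \<xi>)\<bar> powr p \<le> (znorm M \<xi> * grad_gamma_norm \<gamma> u \<xi>) powr p"
        using p by (intro powr_mono2 deriv_dilation_le[OF D(2)]) auto
      also have "\<dots> = grad_gamma_norm \<gamma> u \<xi> powr p * znorm M \<xi> powr p"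
        by (simp add: powr_mult mult.commute)
      finally have "PR \<xi> * znorm M \<xi> powr - real (card M) \<le> (grad_gamma_norm \<gamma> u \<xi> powr p * znorm M \<xi> powr p)
         * (exp (p * a * \<rho> (ln (znorm M \<xi>))) * \<rho>' (ln (znorm M \<xi>)) powr (1 - p)) * znorm M \<xi> powr - real (card M)"
        unfolding PR_def by (intro mult_right_mono) auto
      also have "\<dots> = grad_gamma_norm \<gamma> u \<xi> powr p * wR \<xi>"
        using True by (simp add: wR)
      finally show ?thesis
        using True by (simp add: ennreal_leI flip: ennreal_mult'')
    next
      case False
      then have "PR \<xi> = 0 \<or> ?ind \<xi> = 0" by (auto simp: PR_def D0 indicator_def)
      then show ?thesis by auto
    qed
  qed
  finally show ?thesis .
qed

text \<open>\<open>sharp_dilation\<close> compares the integrals for every \<open>B\<close> below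
  its bound. Taking \<open>B\<close> to be the gradient norm keeps the degenerate weight out of the
  Euclidean argument; what remains is admissibility and support.\<close>

lemma sharp_grushin:
  fixes M :: "'n::finite set" and \<Omega> :: "((real^'n) \<times> (real^'k::finite)) set"
    and wL wR :: "(real^'n) \<times> (real^'k) \<Rightarrow> real"
  assumes p: "p > 1" and M: "M \<noteq> {}" and r0: "r0 > 0" "exp t0 \<le> r0"
    and \<Omega>: "{\<xi>. 0 < znorm M \<xi> \<and> znorm M \<xi> < exp t0 \<and> restnorm M \<xi> < r0} \<subseteq> \<Omega>"
    and \<gamma>: "\<gamma> \<ge> 0" and C: "C > \<bar>a\<bar> powr p"
    and \<rho>: "\<And>t. t \<le> t0 \<Longrightarrow> (\<rho> has_real_derivative \<rho>' t) (at t)" "continuous_on {..t0} \<rho>'"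
           "\<And>t. t \<le> t0 \<Longrightarrow> \<rho>' t > 0"
    and lim: "filterlim \<rho> at_bot at_bot" "((\<lambda>t. exp t / \<rho>' t) \<longlongrightarrow> 0) at_bot"
    and meas [measurable]: "\<rho> \<in> borel_measurable borel" "\<rho>' \<in> borel_measurable borel"
    and wL: "\<And>\<xi>. 0 < znorm M \<xi> \<Longrightarrow> znorm M \<xi> \<le> exp t0 \<Longrightarrow>
        wL \<xi> = exp (p * a * \<rho> (ln (znorm M \<xi>))) * \<rho>' (ln (znorm M \<xi>)) * znorm M \<xi> powr - real (card M)"
    and wR: "\<And>\<xi>. 0 < znorm M \<xi> \<Longrightarrow> znorm M \<xi> \<le> exp t0 \<Longrightarrow>
        wR \<xi> = znorm M \<xi> powr p * (exp (p * a * \<rho> (ln (znorm M \<xi>))) * \<rho>' (ln (znorm M \<xi>)) powr (1 - p))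
          * znorm M \<xi> powr - real (card M)"
  shows "\<exists>u. C1_0 \<Omega> u \<and> (\<integral>\<^sup>+\<xi>\<in>\<Omega>. ennreal (grad_gamma_norm \<gamma> u \<xi> powr p * wR \<xi>) \<partial>lborel)
      < ennreal C * (\<integral>\<^sup>+\<xi>\<in>\<Omega>. ennreal (\<bar>u \<xi>\<bar> powr p * wL \<xi>) \<partial>lborel)"
proof -
  let ?S = "coord_basis M :: ((real^'n) \<times> (real^'k)) set"
  \<comment> \<open>On the support |x| is at most |z| plus the norm of the rest, hence at most
    \<open>exp t0 + r0 \<le> 2 * r0\<close>. The summand 1 ensures \<open>K \<ge> 1\<close>.\<close>
  define K where "K = 1 + (2 * r0) powr \<gamma>"
  have K: "K \<ge> 1" by (simp add: K_def)
  have S: "?S \<subseteq> Basis" "?S \<noteq> {}" using M coord_basis_subset by (auto simp: coord_basis_def)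
  obtain g g' h h' t1 t2 r
    where "\<forall>y. (g has_real_derivative g' y) (at y)" "continuous_on UNIV g'"
      and "\<forall>y. (h has_real_derivative h' y) (at y)" "continuous_on UNIV h'"
      and tr: "t1 \<le> t2" "t2 < t0" "0 < r" "r < r0"
      and g0: "\<forall>y. y < exp (2 * t1) \<or> exp (2 * t2) < y \<longrightarrow> g y = 0 \<and> g' y = 0"
      and h0: "\<forall>y\<ge>r\<^sup>2. h y = 0 \<and> h' y = 0"
      and ineq: "\<forall>B. (\<forall>\<xi>. 0 \<le> B \<xi> \<and> B \<xi> \<le> 2 * znorm M \<xi> * \<bar>g' ((znorm M \<xi>)\<^sup>2) * h ((restnorm M \<xi>)\<^sup>2)\<bar>
              + K * (2 * restnorm M \<xi>) * \<bar>g ((znorm M \<xi>)\<^sup>2) * h' ((restnorm M \<xi>)\<^sup>2)\<bar>) \<longrightarrow>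
          (\<integral>\<^sup>+\<xi>. ennreal ((B \<xi> * znorm M \<xi>) powr p
              * (exp (p * a * \<rho> (ln (znorm M \<xi>))) * \<rho>' (ln (znorm M \<xi>)) powr (1 - p)))
            * ennreal (znorm M (\<xi> :: (real^'n) \<times> (real^'k)) powr - real (card M)) \<partial>lborel)
        < ennreal C * (\<integral>\<^sup>+\<xi>. ennreal (\<bar>g ((znorm M \<xi>)\<^sup>2) * h ((restnorm M \<xi>)\<^sup>2)\<bar> powr p
              * (exp (p * a * \<rho> (ln (znorm M \<xi>))) * \<rho>' (ln (znorm M \<xi>))))
            * ennreal (znorm M (\<xi> :: (real^'n) \<times> (real^'k)) powr - real (card M)) \<partial>lborel)"
    by (rule sharp_dilation[OF S p r0(1) order_trans[OF zero_le_one K] C \<rho> lim meas,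
          unfolded norm_proj_coord_basis norm_proj_compl_coord_basis card_coord_basis],
        assumption, assumption, rule that)
  then have g: "\<And>y. (g has_real_derivative g' y) (at y)" "continuous_on UNIV g'"
    and h: "\<And>y. (h has_real_derivative h' y) (at y)" "continuous_on UNIV h'"
    by blast+
  define u where "u \<xi> = g ((znorm M \<xi>)\<^sup>2) * h ((restnorm M \<xi>)\<^sup>2)" for \<xi> :: "(real^'n) \<times> (real^'k)"
  \<comment> \<open>A compact set bounded away from z = 0 and contained in \<Omega>; it contains the
    supports of both \<open>u\<close> and its gradient.\<close>
  define F where "F = {\<xi> :: (real^'n) \<times> (real^'k). exp t1 \<le> znorm M \<xi> \<and> znorm M \<xi> \<le> exp t2 \<and> restnorm M \<xi> \<le> r}"
  have off: "g ((znorm M \<xi>)\<^sup>2) = 0 \<and> g' ((znorm M \<xi>)\<^sup>2) = 0 \<or> h ((restnorm M \<xi>)\<^sup>2) = 0 \<and> h' ((restnorm M \<xi>)\<^sup>2) = 0"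
    if notF: "\<xi> \<notin> F" for \<xi>
  proof -
    have e: "exp (2 * t) = (exp t)\<^sup>2" for t :: real by (simp add: exp_double)
    consider "znorm M \<xi> < exp t1" | "exp t2 < znorm M \<xi>" | "r < restnorm M \<xi>"
      using notF by (force simp: F_def)
    then show ?thesis
    proof cases
      case 1
      then have "(znorm M \<xi>)\<^sup>2 < exp (2 * t1)" unfolding e by (intro power_strict_mono) auto
      then show ?thesis using g0 by blast
    next
      case 2
      then have "exp (2 * t2) < (znorm M \<xi>)\<^sup>2" unfolding e by (intro power_strict_mono) auto
      then show ?thesis using g0 by blast
    next
      case 3
      then have "r\<^sup>2 \<le> (restnorm M \<xi>)\<^sup>2" using tr by (intro power_mono) auto
      then show ?thesis using h0 by blast
    qed
  qed
  have F_bounds: "0 < znorm M \<xi>" "znorm M \<xi> < exp t0" "restnorm M \<xi> < r0" if "\<xi> \<in> F" for \<xi>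
  proof -
    have "0 < exp t1" "exp t2 < exp t0" using tr by auto
    then show "0 < znorm M \<xi>" "znorm M \<xi> < exp t0" "restnorm M \<xi> < r0"
      using that tr unfolding F_def mem_Collect_eq by linarith+
  qed
  have F\<Omega>: "F \<subseteq> \<Omega>" using F_bounds \<Omega> by blast
  have closedF: "closed F"
    unfolding F_def by (intro closed_Collect_conj closed_Collect_le continuous_on_znorm continuous_on_restnorm continuous_on_const)
  have "bounded F"
  proof (rule boundedI)
    fix \<xi> assume \<xi>: "\<xi> \<in> F"
    have "norm \<xi> \<le> norm (fst \<xi>) + norm (snd \<xi>)" by (metis norm_Pair_le prod.collapse)
    also have "norm (snd \<xi>) \<le> restnorm M \<xi>"
      unfolding restnorm_def by (rule real_le_rsqrt) (simp add: sum_nonneg)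
    also have "norm (fst \<xi>) \<le> znorm M \<xi> + restnorm M \<xi>" by (rule norm_fst_le)
    finally show "norm \<xi> \<le> exp t0 + r0 + r0" using F_bounds[OF \<xi>] by simp
  qed
  then have "compact F" using closedF by (simp add: compact_eq_bounded_closed)
  have supp: "{\<xi>. u \<xi> \<noteq> 0} \<subseteq> F" using off by (force simp: u_def)
  have cl: "closure {\<xi>. u \<xi> \<noteq> 0} \<subseteq> F" by (rule closure_minimal[OF supp closedF])
  have "C1_0 \<Omega> u"
    unfolding C1_0_def
  proof (intro conjI exI allI)
    show "continuous_on UNIV (cutoff_deriv ?S g g' h h')"
      by (rule continuous_on_cutoff_deriv[OF g h])
    show "(u has_derivative blinfun_apply (cutoff_deriv ?S g g' h h' \<xi>)) (at \<xi>)" for \<xi>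
      using has_derivative_cutoff[where S="?S" and x=\<xi>, OF coord_basis_subset g(1) h(1)]
      by (simp add: u_def[abs_def] norm_proj_coord_basis norm_proj_compl_coord_basis)
    show "compact (closure {\<xi>. u \<xi> \<noteq> 0})"
      using cl \<open>compact F\<close> by (metis closed_closure compact_Int_closed inf.absorb_iff2)
    show "closure {\<xi>. u \<xi> \<noteq> 0} \<subseteq> \<Omega>" using cl F\<Omega> by blast
  qed
  have B: "0 \<le> grad_gamma_norm \<gamma> u \<xi> \<and> grad_gamma_norm \<gamma> u \<xi> \<le>
      2 * znorm M \<xi> * \<bar>g' ((znorm M \<xi>)\<^sup>2) * h ((restnorm M \<xi>)\<^sup>2)\<bar>
       + K * (2 * restnorm M \<xi>) * \<bar>g ((znorm M \<xi>)\<^sup>2) * h' ((restnorm M \<xi>)\<^sup>2)\<bar>" for \<xi>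
    unfolding u_def[abs_def]
  proof (intro conjI grad_gamma_norm_cutoff_le g(1) h(1) K grad_gamma_norm_nonneg)
    assume "g ((znorm M \<xi>)\<^sup>2) * h' ((restnorm M \<xi>)\<^sup>2) \<noteq> 0"
    then have "\<xi> \<in> F" using off[of \<xi>] by auto
    then have "norm (fst \<xi>) \<le> 2 * r0" using F_bounds[of \<xi>] norm_fst_le[of \<xi> M] r0 by linarith
    then have "norm (fst \<xi>) powr \<gamma> \<le> (2 * r0) powr \<gamma>" using \<gamma> by (intro powr_mono2) auto
    then show "xweight \<gamma> \<xi> \<le> K" by (auto simp: xweight_def K_def)
  qed
  have gg0: "grad_gamma_norm \<gamma> u \<xi> = 0" if "\<xi> \<notin> F" for \<xi>
    using B[of \<xi>] off[OF that] by (auto intro: antisym)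
  have "(\<integral>\<^sup>+\<xi>\<in>\<Omega>. ennreal (grad_gamma_norm \<gamma> u \<xi> powr p * wR \<xi>) \<partial>lborel)
     \<le> (\<integral>\<^sup>+\<xi>. ennreal ((grad_gamma_norm \<gamma> u \<xi> * znorm M \<xi>) powr p
              * (exp (p * a * \<rho> (ln (znorm M \<xi>))) * \<rho>' (ln (znorm M \<xi>)) powr (1 - p)))
            * ennreal (znorm M \<xi> powr - real (card M)) \<partial>lborel)"
  proof (rule nn_integral_mono)
    fix \<xi>
    have "ennreal (grad_gamma_norm \<gamma> u \<xi> powr p * wR \<xi>) = ennreal ((grad_gamma_norm \<gamma> u \<xi> * znorm M \<xi>) powr p
              * (exp (p * a * \<rho> (ln (znorm M \<xi>))) * \<rho>' (ln (znorm M \<xi>)) powr (1 - p)))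
            * ennreal (znorm M \<xi> powr - real (card M))"
    proof (cases "\<xi> \<in> F")
      case True
      then show ?thesis
        using F_bounds[OF True] by (simp add: wR powr_mult mult_ac flip: ennreal_mult'')
    qed (simp add: gg0)
    then show "ennreal (grad_gamma_norm \<gamma> u \<xi> powr p * wR \<xi>) * indicator \<Omega> \<xi> \<le> ennreal ((grad_gamma_norm \<gamma> u \<xi> * znorm M \<xi>) powr p
              * (exp (p * a * \<rho> (ln (znorm M \<xi>))) * \<rho>' (ln (znorm M \<xi>)) powr (1 - p)))
            * ennreal (znorm M \<xi> powr - real (card M))"
      by (simp add: indicator_def)
  qed
  also have "\<dots> < ennreal C * (\<integral>\<^sup>+\<xi>. ennreal (\<bar>u \<xi>\<bar> powr p
              * (exp (p * a * \<rho> (ln (znorm M \<xi>))) * \<rho>' (ln (znorm M \<xi>))))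
            * ennreal (znorm M \<xi> powr - real (card M)) \<partial>lborel)"
    unfolding u_def using B unfolding u_def[abs_def] by (intro ineq[rule_format])
  also have "(\<integral>\<^sup>+\<xi>. ennreal (\<bar>u \<xi>\<bar> powr p * (exp (p * a * \<rho> (ln (znorm M \<xi>))) * \<rho>' (ln (znorm M \<xi>))))
            * ennreal (znorm M \<xi> powr - real (card M)) \<partial>lborel)
        = (\<integral>\<^sup>+\<xi>\<in>\<Omega>. ennreal (\<bar>u \<xi>\<bar> powr p * wL \<xi>) \<partial>lborel)"
  proof (rule nn_integral_cong)
    fix \<xi>
    show "ennreal (\<bar>u \<xi>\<bar> powr p * (exp (p * a * \<rho> (ln (znorm M \<xi>))) * \<rho>' (ln (znorm M \<xi>))))
            * ennreal (znorm M \<xi> powr - real (card M)) = ennreal (\<bar>u \<xi>\<bar> powr p * wL \<xi>) * indicator \<Omega> \<xi>"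
    proof (cases "\<xi> \<in> F")
      case True
      then show ?thesis
        using F_bounds[OF True] subsetD[OF F\<Omega> True] by (simp add: wL mult.assoc ennreal_mult''[symmetric])
    next
      case False
      then have "u \<xi> = 0" using supp by blast
      then show ?thesis by simp
    qed
  qed
  finally show ?thesis using \<open>C1_0 \<Omega> u\<close> by blast
qed

section \<open>Compact supports and the power weight\<close>

text \<open>The maximum of |z| is attained and is below \<open>R\<close>; a midpoint leaves a gap.
  For the logarithmic weight this gap keeps orbits away from the singularity at |z| = R.\<close>

lemma compact_znorm_bound:
  assumes "compact T" "\<And>\<xi>. \<xi> \<in> T \<Longrightarrow> znorm M \<xi> < R" "R > 0"
  obtains d where "exp d < R" "\<And>\<xi>. \<xi> \<in> T \<Longrightarrow> znorm M \<xi> < exp d"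
proof (cases "T = {}")
  case True
  then show ?thesis using assms(3) that[of "ln (R / 2)"] by simp
next
  case False
  obtain \<zeta> where \<zeta>: "\<zeta> \<in> T" "\<And>\<xi>. \<xi> \<in> T \<Longrightarrow> znorm M \<xi> \<le> znorm M \<zeta>"
    using continuous_attains_sup[OF assms(1) False continuous_on_subset[OF continuous_on_znorm subset_UNIV]] by blast
  have lt: "znorm M \<zeta> < R" "znorm M \<zeta> \<ge> 0" using assms(2) \<zeta>(1) by auto
  define d where "d = ln ((znorm M \<zeta> + R) / 2)"
  have d: "exp d = (znorm M \<zeta> + R) / 2" using lt assms(3) by (simp add: d_def add_nonneg_pos)
  show ?thesis
  proof (rule that[of d])
    show "exp d < R" using lt by (simp add: d)
    show "znorm M \<xi> < exp d" if "\<xi> \<in> T" for \<xi>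
    proof -
      have "znorm M \<zeta> < exp d" using lt by (simp add: d)
      then show ?thesis by (rule le_less_trans[OF \<zeta>(2)[OF that]])
    qed
  qed
qed

lemma C1_0_support:
  assumes "C1_0 \<Omega> u"
  obtains T where "compact T" "T \<subseteq> \<Omega>" "\<And>\<xi>. u \<xi> \<noteq> 0 \<Longrightarrow> \<xi> \<in> T"
  using assms closure_subset[of "{\<xi>. u \<xi> \<noteq> 0}"] that[of "closure {\<xi>. u \<xi> \<noteq> 0}"]
  by (auto simp: C1_0_def)

lemma hardy_power_weight:
  fixes u :: "(real^'n::finite) \<times> (real^'k::finite) \<Rightarrow> real"
  assumes p: "p > 1" and \<Omega>: "real (card M) + \<beta> < 0 \<Longrightarrow> \<Omega> \<subseteq> {\<xi>. znorm M \<xi> \<noteq> 0}" and u: "C1_0 \<Omega> u"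
  shows "ennreal ((\<bar>real (card M) + \<beta>\<bar> / p) powr p) *
           (\<integral>\<^sup>+\<xi>\<in>\<Omega>. ennreal (\<bar>u \<xi>\<bar> powr p * znorm M \<xi> powr \<beta>) \<partial>lborel)
       \<le> (\<integral>\<^sup>+\<xi>\<in>\<Omega>. ennreal (grad_gamma_norm \<gamma> u \<xi> powr p * znorm M \<xi> powr (p + \<beta>)) \<partial>lborel)"
proof -
  \<comment> \<open>Then \<open>p * a - card M = \<beta>\<close>: the invariant measure |z|^(-m)
    d\<xi> absorbs the dimension, and |a|^p is the claimed constant.\<close>
  define a where "a = (real (card M) + \<beta>) / p"
  have pa: "p * a = real (card M) + \<beta>" using p by (simp add: a_def)
  obtain T where T: "compact T" "T \<subseteq> \<Omega>" "\<And>\<xi>. u \<xi> \<noteq> 0 \<Longrightarrow> \<xi> \<in> T"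
    using C1_0_support[OF u] by blast
  have "compact (znorm M ` T)"
    by (rule compact_continuous_image[OF continuous_on_subset[OF continuous_on_znorm subset_UNIV] T(1)])
  then obtain b where b: "\<And>\<xi>. \<xi> \<in> T \<Longrightarrow> norm (znorm M \<xi>) \<le> b"
    using compact_imp_bounded[of "znorm M ` T"] unfolding bounded_iff by auto
  have b': "znorm M \<xi> < \<bar>b\<bar> + 1" if "\<xi> \<in> T" for \<xi>
    using b[OF that] by simp
  obtain d where d: "\<And>\<xi>. \<xi> \<in> T \<Longrightarrow> znorm M \<xi> < exp d"
    using compact_znorm_bound[OF T(1) b'] by (metis abs_ge_zero add_nonneg_pos zero_less_one)
  \<comment> \<open>a < 0 means m + \<beta> < 0, exactly when \<Omega> avoids z = 0; compactness
    then gives a positive lower bound for |z| on the support.\<close>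
  have low: "\<exists>c. \<forall>\<xi>. u \<xi> \<noteq> 0 \<longrightarrow> exp c < znorm M \<xi>" if "a < 0"
  proof (cases "T = {}")
    case True
    then show ?thesis using T(3) by auto
  next
    case False
    have "real (card M) + \<beta> < 0" using that p by (simp add: a_def divide_less_0_iff)
    then have nz: "znorm M \<xi> \<noteq> 0" if "\<xi> \<in> T" for \<xi> using \<Omega> T(2) that by blast
    obtain \<zeta> where \<zeta>: "\<zeta> \<in> T" "\<And>\<xi>. \<xi> \<in> T \<Longrightarrow> znorm M \<zeta> \<le> znorm M \<xi>"
      using continuous_attains_inf[OF T(1) False continuous_on_subset[OF continuous_on_znorm subset_UNIV]] by blast
    have pos: "znorm M \<zeta> > 0" using nz[OF \<zeta>(1)] znorm_nonneg[of M \<zeta>] by linarith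
    have "exp (ln (znorm M \<zeta> / 2)) < znorm M \<xi>" if "u \<xi> \<noteq> 0" for \<xi>
      using \<zeta>(2)[OF T(3)[OF that]] pos by simp
    then show ?thesis by blast
  qed
  have "ennreal (\<bar>a\<bar> powr p) * (\<integral>\<^sup>+\<xi>\<in>\<Omega>. ennreal (\<bar>u \<xi>\<bar> powr p * znorm M \<xi> powr \<beta>) \<partial>lborel)
       \<le> (\<integral>\<^sup>+\<xi>\<in>\<Omega>. ennreal (grad_gamma_norm \<gamma> u \<xi> powr p * znorm M \<xi> powr (p + \<beta>)) \<partial>lborel)"
  proof (rule hardy_grushin[where \<rho>="\<lambda>t. t" and \<rho>'="\<lambda>_. 1" and d=d and M=M, OF p u])
    fix \<xi> :: "(real^'n) \<times> (real^'k)"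
    assume z: "0 < znorm M \<xi>"
    then show "znorm M \<xi> powr \<beta> = exp (p * a * ln (znorm M \<xi>)) * 1 * znorm M \<xi> powr - real (card M)"
      unfolding pa by (simp add: powr_def exp_add[symmetric] algebra_simps)
    show "znorm M \<xi> powr (p + \<beta>) = znorm M \<xi> powr p *
        (exp (p * a * ln (znorm M \<xi>)) * 1 powr (1 - p)) * znorm M \<xi> powr - real (card M)"
      unfolding pa using z by (simp add: powr_def exp_add[symmetric] algebra_simps)
  qed (use T(3) d low in auto)
  then show ?thesis using p by (simp add: a_def)
qed

lemma sharp_power_weight:
  fixes M :: "'n::finite set" and \<Omega> :: "((real^'n) \<times> (real^'k::finite)) set"
  assumes p: "p > 1" and M: "M \<noteq> {}" and r: "r > 0"
    and \<Omega>: "{\<xi>. 0 < znorm M \<xi> \<and> znorm M \<xi> < r \<and> restnorm M \<xi> < r} \<subseteq> \<Omega>"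
    and \<gamma>: "\<gamma> \<ge> 0" and C: "C > (\<bar>real (card M) + \<beta>\<bar> / p) powr p"
  shows "\<exists>u. C1_0 \<Omega> u \<and>
      (\<integral>\<^sup>+\<xi>\<in>\<Omega>. ennreal (grad_gamma_norm \<gamma> u \<xi> powr p * znorm M \<xi> powr (p + \<beta>)) \<partial>lborel)
      < ennreal C * (\<integral>\<^sup>+\<xi>\<in>\<Omega>. ennreal (\<bar>u \<xi>\<bar> powr p * znorm M \<xi> powr \<beta>) \<partial>lborel)"
proof -
  define a where "a = (real (card M) + \<beta>) / p"
  have pa: "p * a = real (card M) + \<beta>" using p by (simp add: a_def)
  have C': "C > \<bar>a\<bar> powr p" using C p by (simp add: a_def)
  show ?thesis
  proof (rule sharp_grushin[where \<rho>="\<lambda>t. t" and \<rho>'="\<lambda>_. 1" and ?t0.0="ln r" and M=M, OF p M r _ _ \<gamma> C'])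
    fix \<xi> :: "(real^'n) \<times> (real^'k)"
    assume z: "0 < znorm M \<xi>"
    then show "znorm M \<xi> powr \<beta> = exp (p * a * ln (znorm M \<xi>)) * 1 * znorm M \<xi> powr - real (card M)"
      unfolding pa by (simp add: powr_def exp_add[symmetric] algebra_simps)
    show "znorm M \<xi> powr (p + \<beta>) = znorm M \<xi> powr p *
        (exp (p * a * ln (znorm M \<xi>)) * 1 powr (1 - p)) * znorm M \<xi> powr - real (card M)"
      unfolding pa using z by (simp add: powr_def exp_add[symmetric] algebra_simps)
  qed (use r \<Omega> in \<open>auto simp: filterlim_ident exp_at_bot\<close>)
qed

section \<open>The logarithmic weight\<close>

lemma has_real_derivative_log_coordinate:
  assumes "R > 0" "t < ln R"
  shows "((\<lambda>t. - ln (ln R - t)) has_real_derivative 1 / (ln R - t)) (at t)"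
  using assms by (auto intro!: derivative_eq_intros)

text \<open>With s = ln(R/z) one has \<rho> = -ln s, \<rho>' = 1/s, and a = -(\<beta> + 1)/p gives
  exp(p a \<rho>) = s^(\<beta>+1). The equality p = m turns |z|^(-m) into |z|^(-p) on the left and
  cancels |z|^p on the right.\<close>

lemma log_weights:
  assumes R: "R > 0" and p: "p = real m" "p > 1" and z: "0 < z" "z < R"
  shows "ln (R / z) powr \<beta> / z powr p
      = exp (p * (- (\<beta> + 1) / p) * - ln (ln R - ln z)) * (1 / (ln R - ln z)) * z powr - real m"
    and "ln (R / z) powr (p + \<beta>)
      = z powr p * (exp (p * (- (\<beta> + 1) / p) * - ln (ln R - ln z)) * (1 / (ln R - ln z)) powr (1 - p)) * z powr - real m"
proof -
  define s where "s = ln R - ln z"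
  have s: "s > 0" "ln (R / z) = s" using R z by (auto simp: s_def ln_div)
  have e: "exp (p * (- (\<beta> + 1) / p) * - ln s) = s powr (\<beta> + 1)"
  proof -
    have "p * (- (\<beta> + 1) / p) = - (\<beta> + 1)" using p by simp
    moreover have "- (\<beta> + 1) * - ln s = (\<beta> + 1) * ln s" by (simp add: algebra_simps)
    ultimately show ?thesis using s by (simp only: powr_def) simp
  qed
  have 1: "s powr (\<beta> + 1) * (1 / s) = s powr \<beta>"
    using s by (simp add: powr_add)
  have "(1 / s) powr (1 - p) = s powr (p - 1)"
    using s by (simp add: powr_divide powr_diff)
  then have 2: "s powr (\<beta> + 1) * (1 / s) powr (1 - p) = s powr (p + \<beta>)"
    by (simp add: powr_add[symmetric] add.commute)
  show "ln (R / z) powr \<beta> / z powr p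
      = exp (p * (- (\<beta> + 1) / p) * - ln (ln R - ln z)) * (1 / (ln R - ln z)) * z powr - real m"
    unfolding s(2) unfolding s_def[symmetric] e 1 using p by (simp add: powr_minus divide_inverse)
  show "ln (R / z) powr (p + \<beta>)
      = z powr p * (exp (p * (- (\<beta> + 1) / p) * - ln (ln R - ln z)) * (1 / (ln R - ln z)) powr (1 - p)) * z powr - real m"
    unfolding s(2) unfolding s_def[symmetric] e 2 using p z by (simp add: powr_minus)
qed

lemma hardy_log_weight:
  fixes u :: "(real^'n::finite) \<times> (real^'k::finite) \<Rightarrow> real"
  assumes p: "p = real (card M)" "p > 1" and R: "R > 0" and \<beta>: "\<beta> < -1" and u: "C1_0 {\<xi>. znorm M \<xi> < R} u"
  shows "ennreal ((\<bar>\<beta> + 1\<bar> / p) powr p) * (\<integral>\<^sup>+\<xi>\<in>{\<xi>. znorm M \<xi> < R}.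
            ennreal (\<bar>u \<xi>\<bar> powr p / znorm M \<xi> powr p * ln (R / znorm M \<xi>) powr \<beta>) \<partial>lborel)
       \<le> (\<integral>\<^sup>+\<xi>\<in>{\<xi>. znorm M \<xi> < R}.
            ennreal (grad_gamma_norm \<gamma> u \<xi> powr p * ln (R / znorm M \<xi>) powr (p + \<beta>)) \<partial>lborel)"
proof -
  let ?a = "- (\<beta> + 1) / p"
  obtain T where T: "compact T" "T \<subseteq> {\<xi>. znorm M \<xi> < R}" "\<And>\<xi>. u \<xi> \<noteq> 0 \<Longrightarrow> \<xi> \<in> T"
    using C1_0_support[OF u] by blast
  obtain d where d: "exp d < R" "\<And>\<xi>. \<xi> \<in> T \<Longrightarrow> znorm M \<xi> < exp d"
    using compact_znorm_bound[OF T(1) _ R, of M] T(2) by blast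
  have dR: "d < ln R" using d(1) R by (metis exp_less_cancel_iff exp_ln)
  have "ennreal (\<bar>?a\<bar> powr p) * (\<integral>\<^sup>+\<xi>\<in>{\<xi>. znorm M \<xi> < R}.
            ennreal (\<bar>u \<xi>\<bar> powr p * (ln (R / znorm M \<xi>) powr \<beta> / znorm M \<xi> powr p)) \<partial>lborel)
       \<le> (\<integral>\<^sup>+\<xi>\<in>{\<xi>. znorm M \<xi> < R}.
            ennreal (grad_gamma_norm \<gamma> u \<xi> powr p * ln (R / znorm M \<xi>) powr (p + \<beta>)) \<partial>lborel)"
  proof (rule hardy_grushin[where \<rho>="\<lambda>t. - ln (ln R - t)" and \<rho>'="\<lambda>t. 1 / (ln R - t)" and d=d and M=M, OF p(2) u])
    show "((\<lambda>t. - ln (ln R - t)) has_real_derivative 1 / (ln R - t)) (at t)" if "t \<le> d" for t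
      using has_real_derivative_log_coordinate[OF R] that dR by simp
    show "1 / (ln R - t) > 0" if "t \<le> d" for t
      using that dR by simp
    show "continuous_on {..d} (\<lambda>t. 1 / (ln R - t))"
      using dR by (intro continuous_intros) auto
    show "znorm M \<xi> < exp d" if "u \<xi> \<noteq> 0" for \<xi>
      using d(2) T(3) that by blast
    \<comment> \<open>\<beta> < -1 is precisely what makes the exponent positive, so
      \<open>u\<close> may be nonzero on z = 0.\<close>
    have "?a > 0" using \<beta> p by simp
    then show "\<exists>c. \<forall>\<xi>. u \<xi> \<noteq> 0 \<longrightarrow> exp c < znorm M \<xi>" if "?a < 0"
      using that by linarith
    fix \<xi> :: "(real^'n) \<times> (real^'k)"
    assume "0 < znorm M \<xi>" "znorm M \<xi> \<le> exp d"
    then have "0 < znorm M \<xi>" "znorm M \<xi> < R" using d(1) by auto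
    note log_weights[OF R p this]
    then show "ln (R / znorm M \<xi>) powr \<beta> / znorm M \<xi> powr p = exp (p * ?a * - ln (ln R - ln (znorm M \<xi>)))
          * (1 / (ln R - ln (znorm M \<xi>))) * znorm M \<xi> powr - real (card M)"
      and "ln (R / znorm M \<xi>) powr (p + \<beta>) = znorm M \<xi> powr p * (exp (p * ?a * - ln (ln R - ln (znorm M \<xi>)))
          * (1 / (ln R - ln (znorm M \<xi>))) powr (1 - p)) * znorm M \<xi> powr - real (card M)" .
  qed auto
  moreover have "\<bar>?a\<bar> = \<bar>\<beta> + 1\<bar> / p" using p by (simp add: abs_minus_commute flip: minus_add_distrib)
  ultimately show ?thesis by simp
qed

lemma sharp_log_weight:
  fixes M :: "'n::finite set"
  assumes p: "p = real (card M)" "p > 1" and R: "R > 0" and \<gamma>: "\<gamma> \<ge> 0" and C: "C > (\<bar>\<beta> + 1\<bar> / p) powr p"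
  shows "\<exists>u :: (real^'n) \<times> (real^'k::finite) \<Rightarrow> real. C1_0 {\<xi>. znorm M \<xi> < R} u \<and>
      (\<integral>\<^sup>+\<xi>\<in>{\<xi>. znorm M \<xi> < R}.
            ennreal (grad_gamma_norm \<gamma> u \<xi> powr p * ln (R / znorm M \<xi>) powr (p + \<beta>)) \<partial>lborel)
      < ennreal C * (\<integral>\<^sup>+\<xi>\<in>{\<xi>. znorm M \<xi> < R}.
            ennreal (\<bar>u \<xi>\<bar> powr p / znorm M \<xi> powr p * ln (R / znorm M \<xi>) powr \<beta>) \<partial>lborel)"
proof -
  let ?a = "- (\<beta> + 1) / p"
  have "\<bar>?a\<bar> = \<bar>\<beta> + 1\<bar> / p" using p by (simp add: abs_minus_commute flip: minus_add_distrib)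
  then have C': "C > \<bar>?a\<bar> powr p" using C by simp
  \<comment> \<open>Any level strictly below ln R would do: the near-extremals live near z = 0, away
    from the singularity of the weight at |z| = R.\<close>
  define t0 where "t0 = ln (R / 2)"
  have t0: "exp t0 = R / 2" "t0 < ln R" using R by (auto simp: t0_def)
  have M: "M \<noteq> {}" using p by auto
  have "\<exists>u :: (real^'n) \<times> (real^'k) \<Rightarrow> real. C1_0 {\<xi>. znorm M \<xi> < R} u \<and>
      (\<integral>\<^sup>+\<xi>\<in>{\<xi>. znorm M \<xi> < R}.
            ennreal (grad_gamma_norm \<gamma> u \<xi> powr p * ln (R / znorm M \<xi>) powr (p + \<beta>)) \<partial>lborel)
      < ennreal C * (\<integral>\<^sup>+\<xi>\<in>{\<xi>. znorm M \<xi> < R}.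
            ennreal (\<bar>u \<xi>\<bar> powr p * (ln (R / znorm M \<xi>) powr \<beta> / znorm M \<xi> powr p)) \<partial>lborel)"
  proof (rule sharp_grushin[where \<rho>="\<lambda>t. - ln (ln R - t)" and \<rho>'="\<lambda>t. 1 / (ln R - t)" and ?t0.0=t0 and M=M,
        OF p(2) M R _ _ \<gamma> C'])
    show "exp t0 \<le> R" using t0 R by simp
    show "{\<xi> :: (real^'n) \<times> (real^'k). 0 < znorm M \<xi> \<and> znorm M \<xi> < exp t0 \<and> restnorm M \<xi> < R} \<subseteq> {\<xi>. znorm M \<xi> < R}"
      using t0 R by auto
    show "((\<lambda>t. - ln (ln R - t)) has_real_derivative 1 / (ln R - t)) (at t)" if "t \<le> t0" for t
      using has_real_derivative_log_coordinate[OF R] that t0 by simp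
    show "1 / (ln R - t) > 0" if "t \<le> t0" for t
      using that t0 by simp
    show "continuous_on {..t0} (\<lambda>t. 1 / (ln R - t))"
      using t0 by (intro continuous_intros) auto
    show "filterlim (\<lambda>t. - ln (ln R - t)) at_bot at_bot" by real_asymp
    show "((\<lambda>t. exp t / (1 / (ln R - t))) \<longlongrightarrow> 0) at_bot" by real_asymp
    fix \<xi> :: "(real^'n) \<times> (real^'k)"
    assume "0 < znorm M \<xi>" "znorm M \<xi> \<le> exp t0"
    then have "0 < znorm M \<xi>" "znorm M \<xi> < R" using t0 R by auto
    note log_weights[OF R p this]
    then show "ln (R / znorm M \<xi>) powr \<beta> / znorm M \<xi> powr p = exp (p * ?a * - ln (ln R - ln (znorm M \<xi>)))
          * (1 / (ln R - ln (znorm M \<xi>))) * znorm M \<xi> powr - real (card M)"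
      and "ln (R / znorm M \<xi>) powr (p + \<beta>) = znorm M \<xi> powr p * (exp (p * ?a * - ln (ln R - ln (znorm M \<xi>)))
          * (1 / (ln R - ln (znorm M \<xi>))) powr (1 - p)) * znorm M \<xi> powr - real (card M)" .
  qed auto
  then show ?thesis by simp
qed

section \<open>The unweighted special cases and the final statement\<close>

text \<open>The set z = 0 lies in a coordinate hyperplane. It must be excluded when comparing with
  the gauge norm: division by zero yields 0, so there the integrand with |z| is 0 while the one with
  the gauge norm may be positive.\<close>

lemma AE_znorm_nonzero:
  assumes "M \<noteq> {}"
  shows "AE \<xi> in lborel. znorm M (\<xi> :: (real^'n::finite) \<times> (real^'k::finite)) \<noteq> 0"
proof -
  obtain i where i: "i \<in> M" using assms by auto
  let ?H = "{\<xi> :: (real^'n) \<times> (real^'k). (axis i 1, 0) \<bullet> \<xi> = 0}"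
  have "negligible ?H"
    by (rule negligible_hyperplane) (simp add: zero_prod_def axis_eq_0_iff)
  moreover have "closed ?H" by (rule closed_hyperplane)
  ultimately have "?H \<in> null_sets lborel"
    by (simp add: negligible_iff_null_sets null_sets_completion_iff)
  moreover have "{\<xi> \<in> space lborel. \<not> znorm M (\<xi> :: (real^'n) \<times> (real^'k)) \<noteq> 0} \<subseteq> ?H"
    using i by (auto simp: znorm_def sum_nonneg_eq_0_iff inner_prod_def inner_axis' )
  ultimately show ?thesis by (rule AE_I')
qed

lemma znorm_le_gauge_norm:
  assumes "\<gamma> \<ge> 0"
  shows "znorm M \<xi> \<le> gauge_norm \<gamma> \<xi>"
proof -
  have "znorm M \<xi> \<le> norm (fst \<xi>)" by (rule znorm_le_norm_fst)
  also have "\<dots> = (norm (fst \<xi>) powr (2 * (1 + \<gamma>))) powr (1 / (2 + 2 * \<gamma>))"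
    using assms by (simp add: powr_powr)
  also have "\<dots> \<le> gauge_norm \<gamma> \<xi>"
    unfolding gauge_norm_def using assms by (intro powr_mono2) auto
  finally show ?thesis .
qed

theorem mainTheorem10:
  fixes \<gamma> :: real and M :: "'n::finite set" and m :: nat
  assumes "\<gamma> \<ge> 0" and "card M = m" and "1 \<le> m"
  shows
   "(\<forall>(p::real) (\<beta>::real) (\<Omega> :: ((real^'n) \<times> (real^'k::finite)) set).
       1 < p \<and> open \<Omega> \<and> (real m + \<beta> < 0 \<longrightarrow> \<Omega> \<subseteq> {\<xi>. znorm M \<xi> \<noteq> 0}) \<longrightarrow>
       (\<forall>u. C1_0 \<Omega> u \<longrightarrow>
          ennreal ((\<bar>real m + \<beta>\<bar> / p) powr p) *
            (\<integral>\<^sup>+\<xi>\<in>\<Omega>. ennreal (\<bar>u \<xi>\<bar> powr p * znorm M \<xi> powr \<beta>) \<partial>lborel)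
          \<le> (\<integral>\<^sup>+\<xi>\<in>\<Omega>. ennreal (grad_gamma_norm \<gamma> u \<xi> powr p * znorm M \<xi> powr (p + \<beta>)) \<partial>lborel))
       \<and> ((\<exists>r>0. {\<xi>. 0 < znorm M \<xi> \<and> znorm M \<xi> < r \<and> restnorm M \<xi> < r} \<subseteq> \<Omega>) \<longrightarrow>
          (\<forall>C > (\<bar>real m + \<beta>\<bar> / p) powr p. \<exists>u. C1_0 \<Omega> u \<and>
             (\<integral>\<^sup>+\<xi>\<in>\<Omega>. ennreal (grad_gamma_norm \<gamma> u \<xi> powr p * znorm M \<xi> powr (p + \<beta>)) \<partial>lborel)
             < ennreal C * (\<integral>\<^sup>+\<xi>\<in>\<Omega>. ennreal (\<bar>u \<xi>\<bar> powr p * znorm M \<xi> powr \<beta>) \<partial>lborel))))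
  \<and> (\<forall>(p::real) (\<Omega> :: ((real^'n) \<times> (real^'k)) set).
       1 < p \<and> open \<Omega> \<and> (real m < p \<longrightarrow> \<Omega> \<subseteq> {\<xi>. znorm M \<xi> \<noteq> 0}) \<longrightarrow>
       (\<forall>u. C1_0 \<Omega> u \<longrightarrow>
          ennreal ((\<bar>real m - p\<bar> / p) powr p) *
            (\<integral>\<^sup>+\<xi>\<in>\<Omega>. ennreal (\<bar>u \<xi>\<bar> powr p / gauge_norm \<gamma> \<xi> powr p) \<partial>lborel)
          \<le> ennreal ((\<bar>real m - p\<bar> / p) powr p) *
            (\<integral>\<^sup>+\<xi>\<in>\<Omega>. ennreal (\<bar>u \<xi>\<bar> powr p / znorm M \<xi> powr p) \<partial>lborel)
        \<and> ennreal ((\<bar>real m - p\<bar> / p) powr p) *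
            (\<integral>\<^sup>+\<xi>\<in>\<Omega>. ennreal (\<bar>u \<xi>\<bar> powr p / znorm M \<xi> powr p) \<partial>lborel)
          \<le> (\<integral>\<^sup>+\<xi>\<in>\<Omega>. ennreal (grad_gamma_norm \<gamma> u \<xi> powr p) \<partial>lborel)))
  \<and> (1 < m \<longrightarrow>
     (\<forall>(R::real) (\<beta>::real). 0 < R \<and> \<beta> < -1 \<longrightarrow>
       (let p = real m; \<Omega> = {\<xi> :: (real^'n) \<times> (real^'k). znorm M \<xi> < R} in
        (\<forall>u. C1_0 \<Omega> u \<longrightarrow>
           ennreal ((\<bar>\<beta> + 1\<bar> / p) powr p) *
             (\<integral>\<^sup>+\<xi>\<in>\<Omega>. ennreal (\<bar>u \<xi>\<bar> powr p / znorm M \<xi> powr p * ln (R / znorm M \<xi>) powr \<beta>) \<partial>lborel)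
           \<le> (\<integral>\<^sup>+\<xi>\<in>\<Omega>. ennreal (grad_gamma_norm \<gamma> u \<xi> powr p * ln (R / znorm M \<xi>) powr (p + \<beta>)) \<partial>lborel))
        \<and> (\<forall>u. C1_0 \<Omega> u \<longrightarrow>
           ennreal (((p - 1) / p) powr p) *
             (\<integral>\<^sup>+\<xi>\<in>\<Omega>. ennreal (\<bar>u \<xi>\<bar> powr p / (znorm M \<xi> * ln (R / znorm M \<xi>)) powr p) \<partial>lborel)
           \<le> (\<integral>\<^sup>+\<xi>\<in>\<Omega>. ennreal (grad_gamma_norm \<gamma> u \<xi> powr p) \<partial>lborel))
        \<and> (\<forall>C > (\<bar>\<beta> + 1\<bar> / p) powr p. \<exists>u. C1_0 \<Omega> u \<and>
             (\<integral>\<^sup>+\<xi>\<in>\<Omega>. ennreal (grad_gamma_norm \<gamma> u \<xi> powr p * ln (R / znorm M \<xi>) powr (p + \<beta>)) \<partial>lborel)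
             < ennreal C * (\<integral>\<^sup>+\<xi>\<in>\<Omega>. ennreal (\<bar>u \<xi>\<bar> powr p / znorm M \<xi> powr p * ln (R / znorm M \<xi>) powr \<beta>) \<partial>lborel)))))"
proof -
  have M: "M \<noteq> {}" using assms by auto
  note m = assms(2)
  show ?thesis
  proof (intro conjI allI impI)
    fix p \<beta> :: real and \<Omega> :: "((real^'n) \<times> (real^'k)) set" and u
    assume "1 < p \<and> open \<Omega> \<and> (real m + \<beta> < 0 \<longrightarrow> \<Omega> \<subseteq> {\<xi>. znorm M \<xi> \<noteq> 0})" "C1_0 \<Omega> u"
    then show "ennreal ((\<bar>real m + \<beta>\<bar> / p) powr p) *
            (\<integral>\<^sup>+\<xi>\<in>\<Omega>. ennreal (\<bar>u \<xi>\<bar> powr p * znorm M \<xi> powr \<beta>) \<partial>lborel)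
          \<le> (\<integral>\<^sup>+\<xi>\<in>\<Omega>. ennreal (grad_gamma_norm \<gamma> u \<xi> powr p * znorm M \<xi> powr (p + \<beta>)) \<partial>lborel)"
      using hardy_power_weight[of p M \<beta> \<Omega> u \<gamma>] m by blast
  next
    fix p \<beta> C :: real and \<Omega> :: "((real^'n) \<times> (real^'k)) set"
    assume "1 < p \<and> open \<Omega> \<and> (real m + \<beta> < 0 \<longrightarrow> \<Omega> \<subseteq> {\<xi>. znorm M \<xi> \<noteq> 0})"
      and "\<exists>r>0. {\<xi>. 0 < znorm M \<xi> \<and> znorm M \<xi> < r \<and> restnorm M \<xi> < r} \<subseteq> \<Omega>"
      and "(\<bar>real m + \<beta>\<bar> / p) powr p < C"
    then show "\<exists>u. C1_0 \<Omega> u \<and>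
             (\<integral>\<^sup>+\<xi>\<in>\<Omega>. ennreal (grad_gamma_norm \<gamma> u \<xi> powr p * znorm M \<xi> powr (p + \<beta>)) \<partial>lborel)
             < ennreal C * (\<integral>\<^sup>+\<xi>\<in>\<Omega>. ennreal (\<bar>u \<xi>\<bar> powr p * znorm M \<xi> powr \<beta>) \<partial>lborel)"
      using sharp_power_weight[where M=M and p=p and \<beta>=\<beta> and \<Omega>=\<Omega> and C=C and \<gamma>=\<gamma>, OF _ M] m assms(1) by blast
  next
    fix p :: real and \<Omega> :: "((real^'n) \<times> (real^'k)) set" and u
    assume *: "1 < p \<and> open \<Omega> \<and> (real m < p \<longrightarrow> \<Omega> \<subseteq> {\<xi>. znorm M \<xi> \<noteq> 0})" "C1_0 \<Omega> u"
    have "AE \<xi> in lborel. znorm M (\<xi> :: (real^'n) \<times> (real^'k)) \<noteq> 0"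
      by (rule AE_znorm_nonzero[OF M])
    then have "AE \<xi> in lborel. ennreal (\<bar>u \<xi>\<bar> powr p / gauge_norm \<gamma> \<xi> powr p) * indicator \<Omega> \<xi>
        \<le> ennreal (\<bar>u \<xi>\<bar> powr p / znorm M \<xi> powr p) * indicator \<Omega> \<xi>"
    proof (rule AE_mp, intro AE_I2 impI)
      fix \<xi> :: "(real^'n) \<times> (real^'k)"
      assume "znorm M \<xi> \<noteq> 0"
      then have "znorm M \<xi> > 0" using znorm_nonneg[of M \<xi>] by linarith
      moreover have "znorm M \<xi> powr p \<le> gauge_norm \<gamma> \<xi> powr p"
        using * assms(1) by (intro powr_mono2 znorm_le_gauge_norm) auto
      ultimately have "\<bar>u \<xi>\<bar> powr p / gauge_norm \<gamma> \<xi> powr p \<le> \<bar>u \<xi>\<bar> powr p / znorm M \<xi> powr p"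
        by (intro divide_left_mono mult_pos_pos) (auto intro: less_le_trans[rotated])
      then show "ennreal (\<bar>u \<xi>\<bar> powr p / gauge_norm \<gamma> \<xi> powr p) * indicator \<Omega> \<xi>
          \<le> ennreal (\<bar>u \<xi>\<bar> powr p / znorm M \<xi> powr p) * indicator \<Omega> \<xi>"
        by (intro mult_right_mono ennreal_leI) auto
    qed
    then show "ennreal ((\<bar>real m - p\<bar> / p) powr p) *
            (\<integral>\<^sup>+\<xi>\<in>\<Omega>. ennreal (\<bar>u \<xi>\<bar> powr p / gauge_norm \<gamma> \<xi> powr p) \<partial>lborel)
          \<le> ennreal ((\<bar>real m - p\<bar> / p) powr p) *
            (\<integral>\<^sup>+\<xi>\<in>\<Omega>. ennreal (\<bar>u \<xi>\<bar> powr p / znorm M \<xi> powr p) \<partial>lborel)"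
      by (intro mult_left_mono nn_integral_mono_AE) auto
    have "ennreal ((\<bar>real m - p\<bar> / p) powr p) *
            (\<integral>\<^sup>+\<xi>\<in>\<Omega>. ennreal (\<bar>u \<xi>\<bar> powr p / znorm M \<xi> powr p) \<partial>lborel)
        = ennreal ((\<bar>real (card M) + (- p)\<bar> / p) powr p) *
            (\<integral>\<^sup>+\<xi>\<in>\<Omega>. ennreal (\<bar>u \<xi>\<bar> powr p * znorm M \<xi> powr (- p)) \<partial>lborel)"
      by (simp add: m powr_minus divide_inverse)
    also have "\<dots> \<le> (\<integral>\<^sup>+\<xi>\<in>\<Omega>. ennreal (grad_gamma_norm \<gamma> u \<xi> powr p * znorm M \<xi> powr (p + (- p))) \<partial>lborel)"
      by (rule hardy_power_weight) (use * m in auto)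
    \<comment> \<open>Only an inequality pointwise: \<open>znorm M \<xi> powr 0\<close> is 0 rather
      than 1 where |z| = 0.\<close>
    also have "\<dots> \<le> (\<integral>\<^sup>+\<xi>\<in>\<Omega>. ennreal (grad_gamma_norm \<gamma> u \<xi> powr p) \<partial>lborel)"
      by (intro nn_integral_mono mult_right_mono ennreal_leI) auto
    finally show "ennreal ((\<bar>real m - p\<bar> / p) powr p) *
            (\<integral>\<^sup>+\<xi>\<in>\<Omega>. ennreal (\<bar>u \<xi>\<bar> powr p / znorm M \<xi> powr p) \<partial>lborel)
          \<le> (\<integral>\<^sup>+\<xi>\<in>\<Omega>. ennreal (grad_gamma_norm \<gamma> u \<xi> powr p) \<partial>lborel)" .
  next
    fix R \<beta> :: real
    assume m1: "1 < m" and R\<beta>: "0 < R \<and> \<beta> < -1"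
    have p: "real m = real (card M)" "real m > 1" using m m1 by auto
    have R: "R > 0" and \<beta>: "\<beta> < -1" using R\<beta> by auto
    let ?\<Omega> = "{\<xi> :: (real^'n) \<times> (real^'k). znorm M \<xi> < R}"
    have special: "ennreal (((real m - 1) / real m) powr real m) *
             (\<integral>\<^sup>+\<xi>\<in>?\<Omega>. ennreal (\<bar>u \<xi>\<bar> powr real m / (znorm M \<xi> * ln (R / znorm M \<xi>)) powr real m) \<partial>lborel)
           \<le> (\<integral>\<^sup>+\<xi>\<in>?\<Omega>. ennreal (grad_gamma_norm \<gamma> u \<xi> powr real m) \<partial>lborel)" if u: "C1_0 ?\<Omega> u" for u
    proof -
      \<comment> \<open>The special case is \<beta> = -m, which is below -1 because m > 1; the
        weight on the gradient then has exponent p + \<beta> = 0.\<close>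
      have "\<bar>- real m + 1\<bar> = real m - 1" using m1 by simp
      moreover have "(\<integral>\<^sup>+\<xi>\<in>?\<Omega>. ennreal (\<bar>u \<xi>\<bar> powr real m / (znorm M \<xi> * ln (R / znorm M \<xi>)) powr real m) \<partial>lborel)
        = (\<integral>\<^sup>+\<xi>\<in>?\<Omega>. ennreal (\<bar>u \<xi>\<bar> powr real m / znorm M \<xi> powr real m * ln (R / znorm M \<xi>) powr (- real m)) \<partial>lborel)"
      proof (rule nn_integral_cong)
        fix \<xi>
        show "ennreal (\<bar>u \<xi>\<bar> powr real m / (znorm M \<xi> * ln (R / znorm M \<xi>)) powr real m) * indicator ?\<Omega> \<xi>
          = ennreal (\<bar>u \<xi>\<bar> powr real m / znorm M \<xi> powr real m * ln (R / znorm M \<xi>) powr (- real m)) * indicator ?\<Omega> \<xi>"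
        proof (cases "znorm M \<xi> > 0 \<and> znorm M \<xi> < R")
          case True
          then have "ln (R / znorm M \<xi>) > 0" by simp
          then show ?thesis using True by (simp add: powr_mult powr_minus divide_inverse mult_ac)
        next
          case False
          \<comment> \<open>At |z| = 0 both quotients have denominator 0 and hence the default value
            0; off the domain the indicators vanish.\<close>
          then have "znorm M \<xi> = 0 \<or> \<xi> \<notin> ?\<Omega>" by (simp add: less_le)
          then show ?thesis by auto
        qed
      qed
      ultimately have "ennreal (((real m - 1) / real m) powr real m) *
             (\<integral>\<^sup>+\<xi>\<in>?\<Omega>. ennreal (\<bar>u \<xi>\<bar> powr real m / (znorm M \<xi> * ln (R / znorm M \<xi>)) powr real m) \<partial>lborel)
          = ennreal ((\<bar>- real m + 1\<bar> / real m) powr real m) *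
            (\<integral>\<^sup>+\<xi>\<in>?\<Omega>. ennreal (\<bar>u \<xi>\<bar> powr real m / znorm M \<xi> powr real m * ln (R / znorm M \<xi>) powr (- real m)) \<partial>lborel)"
        by simp
      also have "\<dots> \<le> (\<integral>\<^sup>+\<xi>\<in>?\<Omega>. ennreal (grad_gamma_norm \<gamma> u \<xi> powr real m * ln (R / znorm M \<xi>) powr (real m + - real m)) \<partial>lborel)"
        by (rule hardy_log_weight[OF p R _ u]) (use m1 in simp)
      also have "\<dots> \<le> (\<integral>\<^sup>+\<xi>\<in>?\<Omega>. ennreal (grad_gamma_norm \<gamma> u \<xi> powr real m) \<partial>lborel)"
        by (intro nn_integral_mono mult_right_mono ennreal_leI) auto
      finally show ?thesis .
    qed
    show "let p = real m; \<Omega> = ?\<Omega> in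
        (\<forall>u. C1_0 \<Omega> u \<longrightarrow>
           ennreal ((\<bar>\<beta> + 1\<bar> / p) powr p) *
             (\<integral>\<^sup>+\<xi>\<in>\<Omega>. ennreal (\<bar>u \<xi>\<bar> powr p / znorm M \<xi> powr p * ln (R / znorm M \<xi>) powr \<beta>) \<partial>lborel)
           \<le> (\<integral>\<^sup>+\<xi>\<in>\<Omega>. ennreal (grad_gamma_norm \<gamma> u \<xi> powr p * ln (R / znorm M \<xi>) powr (p + \<beta>)) \<partial>lborel))
        \<and> (\<forall>u. C1_0 \<Omega> u \<longrightarrow>
           ennreal (((p - 1) / p) powr p) *
             (\<integral>\<^sup>+\<xi>\<in>\<Omega>. ennreal (\<bar>u \<xi>\<bar> powr p / (znorm M \<xi> * ln (R / znorm M \<xi>)) powr p) \<partial>lborel)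
           \<le> (\<integral>\<^sup>+\<xi>\<in>\<Omega>. ennreal (grad_gamma_norm \<gamma> u \<xi> powr p) \<partial>lborel))
        \<and> (\<forall>C > (\<bar>\<beta> + 1\<bar> / p) powr p. \<exists>u. C1_0 \<Omega> u \<and>
             (\<integral>\<^sup>+\<xi>\<in>\<Omega>. ennreal (grad_gamma_norm \<gamma> u \<xi> powr p * ln (R / znorm M \<xi>) powr (p + \<beta>)) \<partial>lborel)
             < ennreal C * (\<integral>\<^sup>+\<xi>\<in>\<Omega>. ennreal (\<bar>u \<xi>\<bar> powr p / znorm M \<xi> powr p * ln (R / znorm M \<xi>) powr \<beta>) \<partial>lborel))"
      unfolding Let_def
    proof (intro conjI allI impI)
      fix u assume "C1_0 ?\<Omega> u"
      then show "ennreal ((\<bar>\<beta> + 1\<bar> / real m) powr real m) *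
             (\<integral>\<^sup>+\<xi>\<in>?\<Omega>. ennreal (\<bar>u \<xi>\<bar> powr real m / znorm M \<xi> powr real m * ln (R / znorm M \<xi>) powr \<beta>) \<partial>lborel)
           \<le> (\<integral>\<^sup>+\<xi>\<in>?\<Omega>. ennreal (grad_gamma_norm \<gamma> u \<xi> powr real m * ln (R / znorm M \<xi>) powr (real m + \<beta>)) \<partial>lborel)"
        by (rule hardy_log_weight[OF p R \<beta>])
    next
      fix C assume "(\<bar>\<beta> + 1\<bar> / real m) powr real m < C"
      then show "\<exists>u. C1_0 ?\<Omega> u \<and>
             (\<integral>\<^sup>+\<xi>\<in>?\<Omega>. ennreal (grad_gamma_norm \<gamma> u \<xi> powr real m * ln (R / znorm M \<xi>) powr (real m + \<beta>)) \<partial>lborel)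
             < ennreal C * (\<integral>\<^sup>+\<xi>\<in>?\<Omega>. ennreal (\<bar>u \<xi>\<bar> powr real m / znorm M \<xi> powr real m * ln (R / znorm M \<xi>) powr \<beta>) \<partial>lborel)"
        by (rule sharp_log_weight[OF p R assms(1)])
    qed (fact special)
  qed
qed

end
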